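(* Let $y,z>0$, $p=y/(y+z)$, and let $$(A,B)\overset{d}{=}I_p(1-L,0)+(1-I_p)(1,R),$$ where $I_p\sim Be(p)$ is independent of the $[0,1)^2$-valued random vector $(L,R)$, with $L\sim\beta(z,y+1)$ and $R\sim\beta(y,z+1)$. Set $a=b=1$. Then all of the following hold. (i) For $V_2\sim\Gamma_b$, $V_1\sim\Gamma_a$ is the unique (in distribution) solution to $V_1\overset{d}{=}AV_1+BV_2$, where $V_1,V_2,(A,B)$ are mutually independent. (ii) $X\sim\beta(a,b)$ is the unique (in distribution) solution to $X\overset{d}{=}AX+B(1-X)$, where $X$ is independent of $(A,B)$. (iii) There is a random variable $Y\sim\beta(a,b)$ such that, as $n\to\infty$, $Y_n(x)\to Y$ almost surely, uniformly in $x\in[0,1]$. (iv) For every $x\in[0,1]$, $X_n(x)$ converges in distribution to $\beta(a,b)$ as $n\to\infty$. (v) For every $x'\in(0,\infty)$, $X'_n(x')$ converges in distribution to $\Gamma_a$ as $n\to\infty$.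
   Context: $\overset{d}{=}$ denotes equality in distribution. $Be(p)$ is the Bernoulli distribution with success probability $p$. $\beta(a,b)$, $a,b>0$, is the beta distribution with density $B(a,b)^{-1}u^{a-1}(1-u)^{b-1}$ on $(0,1)$. $\Gamma_a$, $a>0$, is the gamma distribution with shape $a$ and scale $1$. $F_1\otimes F_2$ denotes the joint law of independent random elements with laws $F_1$, $F_2$. A solution of a random equation is a real random variable (or its law) satisfying it; uniqueness is in distribution. No assumption is made on the dependence between $L$ and $R$. Let $\mu$ be the law of $(A,B)$ and let $(A_1,B_1,V_1),(A_2,B_2,V_2),\dots$ be i.i.d. with law $\mu\otimes\Gamma_b$. Put $F_n(x)=A_nx+B_n(1-x)$ for $x\in[0,1]$ and $G_n(x')=A_nx'+B_nV_n$ for $x'\in(0,\infty)$. Define, for $n\ge1$, $X_n=F_n\circ F_{n-1}\circ\cdots\circ F_1$ (forward iteration), $Y_n=F_1\circ F_2\circ\cdots\circ F_n$ (backward iteration), and $X'_n=G_n\circ G_{n-1}\circ\cdots\circ G_1$. *)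

theory Defs
  imports "HOL-Probability.Probability"
begin

definition beta_law :: "real \<Rightarrow> real \<Rightarrow> real measure" where
  "beta_law a b = density lborel
     (\<lambda>u. ennreal (indicator {0<..<1} u * (u powr (a - 1) * (1 - u) powr (b - 1) / Beta a b)))"

text \<open>Shape \<open>a\<close>, scale \<open>1\<close>.\<close>
definition gamma_law :: "real \<Rightarrow> real measure" where
  "gamma_law a = density lborel
     (\<lambda>u. ennreal (indicator {0<..} u * (u powr (a - 1) * exp (- u) / Gamma a)))"

text \<open>
  Independence of two random elements. The library's \<open>indep_var\<close> only admits two random
  elements with values in the same type; this is its definition for two types.
\<close>
definition indep_elements ::
  "'m measure \<Rightarrow> 'a measure \<Rightarrow> ('m \<Rightarrow> 'a) \<Rightarrow> 'b measure \<Rightarrow> ('m \<Rightarrow> 'b) \<Rightarrow> bool" where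
  "indep_elements M N X N' Y \<longleftrightarrow> X \<in> M \<rightarrow>\<^sub>M N \<and> Y \<in> M \<rightarrow>\<^sub>M N' \<and>
     prob_space.indep_set M {X -` U \<inter> space M |U. U \<in> sets N} {Y -` U \<inter> space M |U. U \<in> sets N'}"

definition beta_map :: "real \<Rightarrow> real \<Rightarrow> real \<Rightarrow> real" where
  "beta_map A B x = A * x + B * (1 - x)"

definition gamma_map :: "real \<Rightarrow> real \<Rightarrow> real \<Rightarrow> real \<Rightarrow> real" where
  "gamma_map A B V x = A * x + B * V"

text \<open>
  The indices of the composed maps start at \<open>1\<close>: the forward iterate is
  \<open>F n \<circ> \<dots> \<circ> F 1\<close>, the backward iterate is \<open>F 1 \<circ> \<dots> \<circ> F n\<close>.
\<close>
primrec forward_iter :: "(nat \<Rightarrow> 'a \<Rightarrow> 'a) \<Rightarrow> nat \<Rightarrow> 'a \<Rightarrow> 'a" where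
  "forward_iter F 0 = id"
| "forward_iter F (Suc n) = F (Suc n) \<circ> forward_iter F n"

primrec backward_iter :: "(nat \<Rightarrow> 'a \<Rightarrow> 'a) \<Rightarrow> nat \<Rightarrow> 'a \<Rightarrow> 'a" where
  "backward_iter F 0 = id"
| "backward_iter F (Suc n) = backward_iter F n \<circ> F (Suc n)"

text \<open>
  Solutions of random equations are laws on the reals. The law \<open>\<kappa>\<close> of \<open>V1\<close> solves
  \<open>V1 = A V1 + B V2\<close> in distribution, where \<open>V1\<close>, \<open>V2\<close>, \<open>(A, B)\<close> are mutually
  independent, \<open>V2\<close> has law \<open>\<nu>\<close> and \<open>(A, B)\<close> has law \<open>\<mu>\<close>.
\<close>
definition solves_gamma_eq :: "(real \<times> real) measure \<Rightarrow> real measure \<Rightarrow> real measure \<Rightarrow> bool" where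
  "solves_gamma_eq \<mu> \<nu> \<kappa> \<longleftrightarrow> prob_space \<kappa> \<and> sets \<kappa> = sets borel \<and>
     distr (\<kappa> \<Otimes>\<^sub>M (\<nu> \<Otimes>\<^sub>M \<mu>)) borel (\<lambda>(v1, v2, A, B). A * v1 + B * v2) = \<kappa>"

text \<open>
  The law \<open>\<kappa>\<close> of \<open>X\<close> solves \<open>X = A X + B (1 - X)\<close> in distribution, where \<open>X\<close> is
  independent of \<open>(A, B)\<close> and \<open>(A, B)\<close> has law \<open>\<mu>\<close>.
\<close>
definition solves_beta_eq :: "(real \<times> real) measure \<Rightarrow> real measure \<Rightarrow> bool" where
  "solves_beta_eq \<mu> \<kappa> \<longleftrightarrow> prob_space \<kappa> \<and> sets \<kappa> = sets borel \<and>
     distr (\<kappa> \<Otimes>\<^sub>M \<mu>) borel (\<lambda>(x, A, B). A * x + B * (1 - x)) = \<kappa>"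

end

theory Submission
  imports Defs
begin

text \<open>
  With \<open>a = b = 1\<close> both equations are affine, \<open>X = C X + Q\<close> in distribution: \<open>(C, Q)\<close> is
  \<open>(A - B, B)\<close> for the beta equation and \<open>(A, B V)\<close> for the gamma equation, with
  \<open>0 \<le> C \<le> 1\<close> and \<open>E C < 1\<close>. In terms of characteristic functions the equation reads
  \<open>\<phi>(t) = E[exp(i t Q) \<phi>(t C)]\<close>, so the difference \<open>d\<close> of two solutions satisfies
  \<open>|d(t)| \<le> E|d(t C)|\<close>. This forces \<open>d = 0\<close>, and along the forward iteration it gives a
  distance of order \<open>|t| (E C)^n\<close> to the solution. A backward iterate is the affine map with slope
  \<open>C\<^sub>1 \<dots> C\<^sub>n\<close>, whose mean \<open>(E C)^n\<close> is summable, whence almost sure convergence.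

  That the uniform and the exponential law are solutions follows from the mixture
  representation of \<open>\<mu>\<close>: draw \<open>w\<close> from \<open>\<beta>(y, z)\<close> and put \<open>(A, B) = (w, 0)\<close> with probability
  \<open>w\<close>, \<open>(A, B) = (1, w)\<close> otherwise. The equation then holds already for each fixed \<open>w\<close>.
\<close>

section \<open>Independence of a recursively built state from the next input\<close>

lemma (in prob_space) distr_Pair_restrict:
  assumes indep: "indep_vars (\<lambda>_. N) Z J" and A: "A \<subseteq> J" "j \<in> J" "j \<notin> A"
    and k[measurable]: "k \<in> PiM A (\<lambda>_. N) \<rightarrow>\<^sub>M N'"
  shows "distr M (N' \<Otimes>\<^sub>M N) (\<lambda>\<omega>. (k (restrict (\<lambda>i. Z i \<omega>) A), Z j \<omega>)) =
    distr M N' (\<lambda>\<omega>. k (restrict (\<lambda>i. Z i \<omega>) A)) \<Otimes>\<^sub>M distr M N (Z j)"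
proof -
  let ?X = "\<lambda>\<omega>. restrict (\<lambda>i. Z i \<omega>) A" and ?Y = "\<lambda>\<omega>. restrict (\<lambda>i. Z i \<omega>) {j}"
  let ?P = "distr M (PiM A (\<lambda>_. N)) ?X" and ?Q = "distr M (PiM {j} (\<lambda>_. N)) ?Y"
  have ind: "indep_var (PiM A (\<lambda>_. N)) ?X (PiM {j} (\<lambda>_. N)) ?Y"
    by (rule indep_var_restrict[OF indep]) (use A in auto)
  note [measurable] = indep_var_rv1[OF ind] indep_var_rv2[OF ind]
  have g[measurable]: "(\<lambda>f. f j) \<in> PiM {j} (\<lambda>_. N) \<rightarrow>\<^sub>M N"
    by (rule measurable_component_singleton) auto
  have PQ: "?P \<Otimes>\<^sub>M ?Q = distr M (PiM A (\<lambda>_. N) \<Otimes>\<^sub>M PiM {j} (\<lambda>_. N)) (\<lambda>\<omega>. (?X \<omega>, ?Y \<omega>))"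
    using ind unfolding indep_var_distribution_eq by auto
  have "distr M N' (\<lambda>\<omega>. k (?X \<omega>)) \<Otimes>\<^sub>M distr M N (Z j) = distr ?P N' k \<Otimes>\<^sub>M distr ?Q N (\<lambda>f. f j)"
    by (simp add: distr_distr comp_def)
  also have "\<dots> = distr (?P \<Otimes>\<^sub>M ?Q) (N' \<Otimes>\<^sub>M N) (\<lambda>(f, g). (k f, g j))"
    by (rule pair_measure_distr)
      (auto intro!: prob_space_imp_sigma_finite prob_space.prob_space_distr prob_space_distr)
  also have "\<dots> = distr M (N' \<Otimes>\<^sub>M N) (\<lambda>\<omega>. (k (?X \<omega>), Z j \<omega>))"
    unfolding PQ by (subst distr_distr) (auto simp: comp_def)
  finally show ?thesis ..
qed

text \<open>The state \<open>T n\<close> is a measurable function of the inputs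
  \<open>Z 1, ..., Z n\<close> alone, and \<open>Z (Suc n)\<close> is independent of that block. The
  state space \<open>N'\<close> is general because the recursion is run both with real values and
  with pairs of an offset and a slope.\<close>

lemma (in prob_space) recursion_law:
  fixes Z :: "nat \<Rightarrow> 'a \<Rightarrow> 'b" and T :: "nat \<Rightarrow> 'a \<Rightarrow> 'c"
  assumes indep: "indep_vars (\<lambda>_. N) Z {1..}"
    and H: "(\<lambda>(s, w). H s w) \<in> N' \<Otimes>\<^sub>M N \<rightarrow>\<^sub>M N'"
    and t0: "t0 \<in> space N'"
    and T0: "\<And>\<omega>. T 0 \<omega> = t0"
    and TSuc: "\<And>n \<omega>. T (Suc n) \<omega> = H (T n \<omega>) (Z (Suc n) \<omega>)"
  shows "T n \<in> M \<rightarrow>\<^sub>M N'"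
    and "distr M (N' \<Otimes>\<^sub>M N) (\<lambda>\<omega>. (T n \<omega>, Z (Suc n) \<omega>)) =
         distr M N' (T n) \<Otimes>\<^sub>M distr M N (Z (Suc n))"
proof -
  let ?past = "\<lambda>n \<omega>. restrict (\<lambda>i. Z i \<omega>) {1..n}"
  have Z[measurable]: "Z (Suc n) \<in> M \<rightarrow>\<^sub>M N" for n
    using indep by (auto simp: indep_vars_def)
  \<comment> \<open>For \<open>n = 0\<close> the product is over the empty index set and
    \<open>k\<close> is the constant \<open>t0\<close>.\<close>
  have "\<exists>k \<in> PiM {1..n} (\<lambda>_. N) \<rightarrow>\<^sub>M N'. \<forall>\<omega>. T n \<omega> = k (?past n \<omega>)" for n
  proof (induction n)
    case 0
    show ?case by (intro bexI[of _ "\<lambda>_. t0"]) (simp_all add: T0 t0)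
  next
    case (Suc n)
    then obtain k where k[measurable]: "k \<in> PiM {1..n} (\<lambda>_. N) \<rightarrow>\<^sub>M N'"
      and T: "\<And>\<omega>. T n \<omega> = k (?past n \<omega>)" by blast
    have [measurable]: "(\<lambda>f. restrict f {1..n}) \<in> PiM {1..Suc n} (\<lambda>_. N) \<rightarrow>\<^sub>M PiM {1..n} (\<lambda>_. N)"
      by (rule measurable_restrict_subset) auto
    have [measurable]: "(\<lambda>f. f (Suc n)) \<in> PiM {1..Suc n} (\<lambda>_. N) \<rightarrow>\<^sub>M N"
      by (rule measurable_component_singleton) auto
    have "(\<lambda>f. (\<lambda>(s, w). H s w) (k (restrict f {1..n}), f (Suc n))) \<in> PiM {1..Suc n} (\<lambda>_. N) \<rightarrow>\<^sub>M N'"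
      by (rule measurable_compose[OF _ H]) measurable
    moreover have past: "restrict (?past (Suc n) \<omega>) {1..n} = ?past n \<omega>" for \<omega>
      by (auto simp: restrict_def)
    have "\<forall>\<omega>. T (Suc n) \<omega> = H (k (restrict (?past (Suc n) \<omega>) {1..n})) (?past (Suc n) \<omega> (Suc n))"
      unfolding past by (simp add: TSuc T)
    ultimately show ?case
      by (intro bexI[of _ "\<lambda>f. H (k (restrict f {1..n})) (f (Suc n))"]) (simp_all only: prod.case simp_thms)
  qed
  then obtain k where k[measurable]: "k \<in> PiM {1..n} (\<lambda>_. N) \<rightarrow>\<^sub>M N'"
    and T: "T n = (\<lambda>\<omega>. k (?past n \<omega>))" by fast
  have "?past n \<in> M \<rightarrow>\<^sub>M PiM {1..n} (\<lambda>_. N)"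
    using indep by (intro measurable_restrict) (auto simp: indep_vars_def)
  then show "T n \<in> M \<rightarrow>\<^sub>M N'"
    unfolding T using k by (rule measurable_compose)
  show "distr M (N' \<Otimes>\<^sub>M N) (\<lambda>\<omega>. (T n \<omega>, Z (Suc n) \<omega>)) =
         distr M N' (T n) \<Otimes>\<^sub>M distr M N (Z (Suc n))"
    unfolding T by (rule distr_Pair_restrict[OF indep _ _ _ k]) auto
qed

section \<open>Affine random recursions\<close>

definition solves_affine :: "(real \<times> real) measure \<Rightarrow> real measure \<Rightarrow> bool" where
  "solves_affine \<Lambda> \<kappa> \<longleftrightarrow> prob_space \<kappa> \<and> sets \<kappa> = sets borel \<and>
     distr (\<kappa> \<Otimes>\<^sub>M \<Lambda>) borel (\<lambda>(x, c, q). c * x + q) = \<kappa>"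

locale affine_recursion = prob_space \<Lambda> for \<Lambda> :: "(real \<times> real) measure" +
  assumes sets_\<Lambda> [measurable_cong]: "sets \<Lambda> = sets (borel \<Otimes>\<^sub>M borel)"
    and slope_range: "AE w in \<Lambda>. 0 \<le> fst w \<and> fst w \<le> 1"
    and slope_mean: "(\<integral>w. fst w \<partial>\<Lambda>) < 1"
begin

lemma integrable_slope: "integrable \<Lambda> fst"
  by (rule integrable_const_bound[of _ 1]) (use slope_range in auto)

text \<open>Fubini, with \<open>x\<close> integrated first: for fixed coefficients the exponential
  splits and the inner integral is \<open>char \<kappa>\<close> at \<open>t * fst w\<close>.\<close>

lemma char_affine:
  assumes "real_distribution \<kappa>"
  shows "char (distr (\<kappa> \<Otimes>\<^sub>M \<Lambda>) borel (\<lambda>(x, c, q). c * x + q)) t =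
    (CLINT w|\<Lambda>. iexp (t * snd w) * char \<kappa> (t * fst w))"
proof -
  interpret \<kappa>: real_distribution \<kappa> by fact
  interpret pair_prob_space \<kappa> \<Lambda> ..
  let ?f = "\<lambda>x w. iexp (t * (fst w * x + snd w))"
  have "integrable (\<kappa> \<Otimes>\<^sub>M \<Lambda>) (\<lambda>(x, w). ?f x w)"
    by (rule integrable_const_bound[of _ 1]) (auto simp: split_beta)
  note 1 = integral_snd[OF this]
  have "char (distr (\<kappa> \<Otimes>\<^sub>M \<Lambda>) borel (\<lambda>(x, c, q). c * x + q)) t = (CLINT z|\<kappa> \<Otimes>\<^sub>M \<Lambda>. (\<lambda>(x, w). ?f x w) z)"
    unfolding char_def by (subst integral_distr) (simp_all add: split_beta')
  also have "\<dots> = (CLINT w|\<Lambda>. CLINT x|\<kappa>. ?f x w)" by (rule 1[symmetric])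
  also have "\<dots> = (CLINT w|\<Lambda>. CLINT x|\<kappa>. iexp (t * snd w) * iexp (t * fst w * x))"
    by (simp add: exp_add[symmetric] algebra_simps)
  finally show ?thesis unfolding char_def by simp
qed

text \<open>Levy uniqueness turns an equation between measures into one that is linear in
  \<open>char \<kappa>\<close>, so that two solutions can be subtracted.\<close>

lemma solves_affine_iff_char:
  "solves_affine \<Lambda> \<kappa> \<longleftrightarrow> real_distribution \<kappa> \<and>
     (\<forall>t. char \<kappa> t = (CLINT w|\<Lambda>. iexp (t * snd w) * char \<kappa> (t * fst w)))"
proof (cases "real_distribution \<kappa>")
  case True
  interpret \<kappa>: real_distribution \<kappa> by fact
  interpret pair_prob_space \<kappa> \<Lambda> ..
  have "real_distribution (distr (\<kappa> \<Otimes>\<^sub>M \<Lambda>) borel (\<lambda>(x, c, q). c * x + q))"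
    by (intro real_distribution_distr) measurable
  then have "distr (\<kappa> \<Otimes>\<^sub>M \<Lambda>) borel (\<lambda>(x, c, q). c * x + q) = \<kappa> \<longleftrightarrow>
     char (distr (\<kappa> \<Otimes>\<^sub>M \<Lambda>) borel (\<lambda>(x, c, q). c * x + q)) = char \<kappa>"
    using Levy_uniqueness True by auto
  also have "\<dots> \<longleftrightarrow> (\<forall>t. char \<kappa> t = (CLINT w|\<Lambda>. iexp (t * snd w) * char \<kappa> (t * fst w)))"
    unfolding fun_eq_iff char_affine[OF True] by (intro iff_allI eq_commute)
  finally show ?thesis
    unfolding solves_affine_def using True \<kappa>.prob_space_axioms \<kappa>.events_eq_borel by blast
qed (auto simp: solves_affine_def real_distribution_def real_distribution_axioms_def)

text \<open>At the smallest point of \<open>[0, r]\<close> where \<open>h\<close> is maximal, averaging over strictly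
  smaller points cannot reproduce the maximum unless it is \<open>0\<close>.\<close>
lemma sub_averaging_nonpos:
  fixes h :: "real \<Rightarrow> real"
  assumes cont: "continuous_on UNIV h" and h0: "h 0 = 0" and bdd: "\<And>t. \<bar>h t\<bar> \<le> C"
    and sub: "\<And>t. h t \<le> (\<integral>w. h (t * fst w) \<partial>\<Lambda>)" and "r \<ge> 0"
  shows "h r \<le> 0"
proof (rule ccontr)
  assume r: "\<not> h r \<le> 0"
  have [measurable]: "h \<in> borel_measurable borel" using cont by (rule borel_measurable_continuous_onI)
  obtain m where m: "m \<in> {0..r}" and mmax: "\<And>x. x \<in> {0..r} \<Longrightarrow> h x \<le> h m"
    using continuous_attains_sup[of "{0..r}" h] \<open>r \<ge> 0\<close> continuous_on_subset[OF cont] by auto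
  let ?E = "{0..r} \<inter> h -` {h m}"
  have "closed (h -` {h m})" by (rule continuous_closed_vimage[OF _ ]) (use cont in \<open>auto simp: continuous_on_eq_continuous_at\<close>)
  then have "compact ?E" by (intro compact_Int_closed) auto
  moreover have "?E \<noteq> {}" using m by auto
  ultimately obtain s where s: "s \<in> ?E" and smin: "\<And>x. x \<in> ?E \<Longrightarrow> s \<le> x"
    using compact_attains_inf[of ?E] by blast
  have hs: "h s > 0" using s r mmax[of r] \<open>r \<ge> 0\<close> by auto
  then have "s > 0" using s h0 by (cases "s = 0") auto
  have strict: "h (s * c) < h s" if "0 \<le> c" "c < 1" for c
  proof -
    have "s * c < s" using that \<open>s > 0\<close> by simp
    moreover have "s * c \<in> {0..r}" using that s \<open>s > 0\<close> \<open>s * c < s\<close>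
      by (smt (verit) IntD1 atLeastAtMost_iff mult_nonneg_nonneg)
    moreover have "s * c \<notin> ?E" using smin[of "s * c"] \<open>s * c < s\<close> by linarith
    ultimately have "h (s * c) \<le> h m" "h (s * c) \<noteq> h m" using mmax[of "s * c"] by blast+
    then show ?thesis using s by simp
  qed
  have int: "integrable \<Lambda> (\<lambda>w. h (s * fst w))"
    by (rule integrable_const_bound[of _ C]) (use bdd in auto)
  have le: "AE w in \<Lambda>. h (s * fst w) \<le> h s"
    using slope_range by eventually_elim (use strict in \<open>force simp: le_less\<close>)
  have "(\<integral>w. h s - h (s * fst w) \<partial>\<Lambda>) \<le> 0"
    using sub[of s] int by (simp add: prob_space)
  moreover have "(\<integral>w. h s - h (s * fst w) \<partial>\<Lambda>) \<ge> 0"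
    by (rule integral_nonneg_AE) (use le in auto)
  ultimately have "AE w in \<Lambda>. h s - h (s * fst w) = 0"
    using integral_nonneg_eq_0_iff_AE[of \<Lambda> "\<lambda>w. h s - h (s * fst w)"] int le by auto
  \<comment> \<open>By \<open>strict\<close>, a slope below \<open>1\<close> makes the integrand
    positive. Hence the slope is almost surely \<open>1\<close>, against
    \<open>slope_mean\<close>.\<close>
  then have "AE w in \<Lambda>. fst w = 1"
    using slope_range by eventually_elim (use strict in force)
  then have "(\<integral>w. fst w \<partial>\<Lambda>) = (\<integral>w. 1 \<partial>\<Lambda>)" by (intro integral_cong_AE) auto
  then show False using slope_mean by (simp add: prob_space)
qed

text \<open>The modulus of the difference of the characteristic functions is continuous, bounded by
  \<open>2\<close> and \<open>0\<close> at \<open>0\<close>, and it is sub-averaging because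
  \<open>iexp (t * snd w)\<close> has modulus \<open>1\<close>; so
  \<open>sub_averaging_nonpos\<close> applies. This route covers all probability laws, whereas the
  contraction estimate for the forward iteration relies on a first moment.\<close>

lemma solves_affine_unique:
  assumes "solves_affine \<Lambda> \<kappa>" and "solves_affine \<Lambda> \<kappa>'"
  shows "\<kappa> = \<kappa>'"
proof -
  interpret \<kappa>: real_distribution \<kappa> using assms unfolding solves_affine_iff_char by blast
  interpret \<kappa>': real_distribution \<kappa>' using assms unfolding solves_affine_iff_char by blast
  have int: "integrable \<Lambda> (\<lambda>w. iexp (t * snd w) * char \<kappa> (t * fst w))"
      "integrable \<Lambda> (\<lambda>w. iexp (t * snd w) * char \<kappa>' (t * fst w))" for t
    by (rule integrable_const_bound[of _ 1];
      auto simp: norm_mult intro!: \<kappa>.cmod_char_le_1 \<kappa>'.cmod_char_le_1)+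
  let ?d = "\<lambda>t. cmod (char \<kappa> t - char \<kappa>' t)"
  have le2: "?d t \<le> 2" for t
    using norm_triangle_ineq4[of "char \<kappa> t" "char \<kappa>' t"] \<kappa>.cmod_char_le_1[of t] \<kappa>'.cmod_char_le_1[of t]
    by linarith
  have sub: "?d t \<le> (\<integral>w. ?d (t * fst w) \<partial>\<Lambda>)" for t
  proof -
    have "char \<kappa> t = (CLINT w|\<Lambda>. iexp (t * snd w) * char \<kappa> (t * fst w))"
        "char \<kappa>' t = (CLINT w|\<Lambda>. iexp (t * snd w) * char \<kappa>' (t * fst w))"
      using assms unfolding solves_affine_iff_char by blast+
    then have "char \<kappa> t - char \<kappa>' t = (CLINT w|\<Lambda>. iexp (t * snd w) * char \<kappa> (t * fst w)) -
        (CLINT w|\<Lambda>. iexp (t * snd w) * char \<kappa>' (t * fst w))"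
      by (rule arg_cong2)
    also have "\<dots> = (CLINT w|\<Lambda>. iexp (t * snd w) * (char \<kappa> (t * fst w) - char \<kappa>' (t * fst w)))"
      using int by (simp add: right_diff_distrib)
    finally have eq: "char \<kappa> t - char \<kappa>' t =
        (CLINT w|\<Lambda>. iexp (t * snd w) * (char \<kappa> (t * fst w) - char \<kappa>' (t * fst w)))" .
    have "?d t \<le> (\<integral>w. cmod (iexp (t * snd w) * (char \<kappa> (t * fst w) - char \<kappa>' (t * fst w))) \<partial>\<Lambda>)"
      unfolding eq by (rule integral_norm_bound)
    then show ?thesis by (simp add: norm_mult)
  qed
  have cont: "continuous_on UNIV ?d"
    using \<kappa>.isCont_char \<kappa>'.isCont_char
    by (intro continuous_at_imp_continuous_on ballI isCont_norm isCont_diff) auto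
  have "?d t \<le> 0" for t
  proof (cases "t \<ge> 0")
    case True
    show ?thesis
      by (rule sub_averaging_nonpos[of ?d 2, OF cont _ _ sub True])
        (use le2 in \<open>auto simp: \<kappa>.char_zero \<kappa>'.char_zero\<close>)
  next
    case False
    \<comment> \<open>The averaging lemma speaks of nonnegative points; a negative \<open>t\<close>
      is reached through the reflected function at \<open>- t\<close>.\<close>
    have "?d (- (- t)) \<le> 0"
    proof (rule sub_averaging_nonpos[of "\<lambda>t. ?d (- t)" 2])
      show "continuous_on UNIV (\<lambda>t. ?d (- t))"
        by (rule continuous_on_compose2[OF cont]) (auto intro: continuous_intros)
      show "?d (- t) \<le> (\<integral>w. ?d (- (t * fst w)) \<partial>\<Lambda>)" for t
        using sub[of "- t"] by simp
    qed (use le2 False in \<open>auto simp: \<kappa>.char_zero \<kappa>'.char_zero\<close>)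
    then show ?thesis by simp
  qed
  then have "char \<kappa> = char \<kappa>'" by (auto simp: fun_eq_iff)
  then show ?thesis by (rule Levy_uniqueness[OF \<kappa>.real_distribution_axioms \<kappa>'.real_distribution_axioms])
qed

end

section \<open>Convergence of forward iterates of independent affine maps\<close>

locale iid_affine_maps = affine_recursion \<Lambda> + S: prob_space S
  for \<Lambda> :: "(real \<times> real) measure" and S :: "'s measure" +
  fixes P Q :: "nat \<Rightarrow> 's \<Rightarrow> real" and \<kappa> :: "real measure"
  assumes indep_PQ: "S.indep_vars (\<lambda>_. borel \<Otimes>\<^sub>M borel) (\<lambda>n \<omega>. (P n \<omega>, Q n \<omega>)) {1..}"
    and law_PQ: "\<And>n. n \<ge> 1 \<Longrightarrow> distr S (borel \<Otimes>\<^sub>M borel) (\<lambda>\<omega>. (P n \<omega>, Q n \<omega>)) = \<Lambda>"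
    and solution: "solves_affine \<Lambda> \<kappa>"
    and integrable_solution: "integrable \<kappa> (\<lambda>x. x)"
begin

sublocale \<kappa>: real_distribution \<kappa>
  using solution unfolding solves_affine_iff_char by blast

lemma PQ_measurable [measurable]:
  "P (Suc n) \<in> borel_measurable S" "Q (Suc n) \<in> borel_measurable S"
proof -
  have "(\<lambda>\<omega>. (P (Suc n) \<omega>, Q (Suc n) \<omega>)) \<in> S \<rightarrow>\<^sub>M borel \<Otimes>\<^sub>M borel"
    using indep_PQ by (auto simp: S.indep_vars_def)
  from measurable_compose[OF this measurable_fst] measurable_compose[OF this measurable_snd]
  show "P (Suc n) \<in> borel_measurable S" "Q (Suc n) \<in> borel_measurable S" by simp_all
qed

lemma char_solution:
  "char \<kappa> t = (CLINT w|\<Lambda>. iexp (t * snd w) * char \<kappa> (t * fst w))"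
  using solution unfolding solves_affine_iff_char by blast

text \<open>Each step averages the distance of the characteristic functions over
  \<open>t * c\<close>, which gains a factor equal to the mean slope. The distance decays
  geometrically for each \<open>t\<close>, and Levy continuity concludes.\<close>

lemma forward_weak_conv:
  assumes T0: "\<And>\<omega>. T 0 \<omega> = x" and TSuc: "\<And>n \<omega>. T (Suc n) \<omega> = P (Suc n) \<omega> * T n \<omega> + Q (Suc n) \<omega>"
  shows "weak_conv_m (\<lambda>n. distr S borel (T n)) \<kappa>"
proof -
  note R = S.recursion_law[OF indep_PQ, of "\<lambda>s (c, q). c * s + q" borel x T]
  have Tm[measurable]: "T n \<in> borel_measurable S" for n
    by (rule R) (auto simp: T0 TSuc)
  interpret D: real_distribution "distr S borel (T n)" for n
    by (rule S.real_distribution_distr) simp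
  have joint: "distr S (borel \<Otimes>\<^sub>M (borel \<Otimes>\<^sub>M borel)) (\<lambda>\<omega>. (T n \<omega>, P (Suc n) \<omega>, Q (Suc n) \<omega>)) =
      distr S borel (T n) \<Otimes>\<^sub>M \<Lambda>" for n
    using R(2)[of n] law_PQ[of "Suc n"] by (simp add: T0 TSuc)
  have step: "distr S borel (T (Suc n)) = distr (distr S borel (T n) \<Otimes>\<^sub>M \<Lambda>) borel (\<lambda>(x, c, q). c * x + q)" for n
    unfolding joint[symmetric] by (subst distr_distr) (auto simp: comp_def TSuc intro!: distr_cong)
  define \<rho> where "\<rho> = (\<integral>w. fst w \<partial>\<Lambda>)"
  have \<rho>: "0 \<le> \<rho>" "\<rho> < 1" using slope_mean slope_range by (auto simp: \<rho>_def intro!: integral_nonneg_AE)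
  \<comment> \<open>This bounds the mean distance between the starting point \<open>x\<close> and a
    value with law \<open>\<kappa>\<close>.\<close>
  define C where "C = \<bar>x\<bar> + (\<integral>u. \<bar>u\<bar> \<partial>\<kappa>)"
  let ?d = "\<lambda>n t. cmod (char (distr S borel (T n)) t - char \<kappa> t)"
  \<comment> \<open>The bound is linear in \<open>\<bar>t\<bar>\<close> and proved for all
    \<open>t\<close> at once: the induction hypothesis is used at \<open>t * fst w\<close>, and the
    integral of the extra factor \<open>fst w\<close> is the next \<open>\<rho>\<close>.\<close>
  have bound: "?d n t \<le> C * \<bar>t\<bar> * \<rho> ^ n" for n t
  proof (induction n arbitrary: t)
    case 0
    have "char (distr S borel (T 0)) t = iexp (t * x)"
      by (simp add: char_def integral_distr T0 S.prob_space)
    also have "\<dots> = (CLINT u|\<kappa>. iexp (t * x))" by (simp add: \<kappa>.prob_space del: \<kappa>.space_eq_univ)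
    finally have "char (distr S borel (T 0)) t - char \<kappa> t = (CLINT u|\<kappa>. iexp (t * x) - iexp (t * u))"
      unfolding char_def[of \<kappa>]
      by (subst Bochner_Integration.integral_diff) (auto intro!: \<kappa>.integrable_iexp)
    then have "?d 0 t \<le> (\<integral>u. cmod (iexp (t * x) - iexp (t * u)) \<partial>\<kappa>)"
      by (simp only:) (rule integral_norm_bound)
    also have "\<dots> \<le> (\<integral>u. \<bar>t\<bar> * (\<bar>x\<bar> + \<bar>u\<bar>) \<partial>\<kappa>)"
    proof (rule integral_mono)
      show "integrable \<kappa> (\<lambda>u. cmod (iexp (t * x) - iexp (t * u)))"
        by (intro integrable_norm Bochner_Integration.integrable_diff \<kappa>.integrable_iexp) auto
      fix u
      \<comment> \<open>Pulling out the unimodular \<open>iexp (t * u)\<close> leaves a difference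
        from \<open>1\<close>, to which the Taylor bound of order \<open>0\<close> applies.\<close>
      have "cmod (iexp (t * x) - iexp (t * u)) = cmod (exp (\<i> * complex_of_real (t * u)) * (iexp (t * (x - u)) - 1))"
        by (simp add: right_diff_distrib exp_add[symmetric] algebra_simps)
      also have "\<dots> = cmod (iexp (t * (x - u)) - 1)" by (simp add: norm_mult del: of_real_mult of_real_diff)
      also have "\<dots> \<le> \<bar>t * (x - u)\<bar>" using iexp_approx1[of "t * (x - u)" 0] by simp
      also have "\<dots> \<le> \<bar>t\<bar> * (\<bar>x\<bar> + \<bar>u\<bar>)" by (auto simp: abs_mult intro!: mult_left_mono)
      finally show "cmod (iexp (t * x) - iexp (t * u)) \<le> \<bar>t\<bar> * (\<bar>x\<bar> + \<bar>u\<bar>)" .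
    qed (use integrable_solution in auto)
    also have "\<dots> = C * \<bar>t\<bar> * \<rho> ^ 0"
      using integrable_solution by (simp add: C_def \<kappa>.prob_space distrib_right mult.commute del: \<kappa>.space_eq_univ)
    finally show ?case .
  next
    case (Suc n)
    have int: "integrable \<Lambda> (\<lambda>w. iexp (t * snd w) * char (distr S borel (T n)) (t * fst w))"
      "integrable \<Lambda> (\<lambda>w. iexp (t * snd w) * char \<kappa> (t * fst w))"
      by (rule integrable_const_bound[of _ 1];
        auto simp: norm_mult intro!: \<kappa>.cmod_char_le_1 D.cmod_char_le_1)+
    have "char (distr S borel (T (Suc n))) t - char \<kappa> t =
        (CLINT w|\<Lambda>. iexp (t * snd w) * (char (distr S borel (T n)) (t * fst w) - char \<kappa> (t * fst w)))"
      unfolding step char_affine[OF D.real_distribution_axioms]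
      by (subst char_solution) (use int in \<open>simp add: right_diff_distrib\<close>)
    then have "?d (Suc n) t \<le> (\<integral>w. cmod (iexp (t * snd w) * (char (distr S borel (T n)) (t * fst w) - char \<kappa> (t * fst w))) \<partial>\<Lambda>)"
      by (simp only:) (rule integral_norm_bound)
    also have "\<dots> = (\<integral>w. ?d n (t * fst w) \<partial>\<Lambda>)" by (simp add: norm_mult)
    also have "\<dots> \<le> (\<integral>w. (C * \<bar>t\<bar> * \<rho> ^ n) * fst w \<partial>\<Lambda>)"
    proof (rule integral_mono_AE)
      have "integrable \<Lambda> (\<lambda>w. iexp (t * snd w) * (char (distr S borel (T n)) (t * fst w) - char \<kappa> (t * fst w)))"
        using int by (simp add: right_diff_distrib)
      from integrable_norm[OF this] show "integrable \<Lambda> (\<lambda>w. ?d n (t * fst w))" by (simp add: norm_mult)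
      show "AE w in \<Lambda>. ?d n (t * fst w) \<le> (C * \<bar>t\<bar> * \<rho> ^ n) * fst w"
        using slope_range
      proof eventually_elim
        case (elim w)
        then show ?case using Suc.IH[of "t * fst w"] by (simp add: abs_mult mult_ac)
      qed
    qed (simp add: integrable_slope)
    also have "\<dots> = C * \<bar>t\<bar> * \<rho> ^ Suc n" by (simp add: \<rho>_def)
    finally show ?case .
  qed
  show ?thesis
  proof (rule levy_continuity)
    fix t
    have "(\<lambda>n. C * \<bar>t\<bar> * \<rho> ^ n) \<longlonglongrightarrow> C * \<bar>t\<bar> * 0"
      using \<rho> by (intro tendsto_mult tendsto_const LIMSEQ_realpow_zero)
    then have "(\<lambda>n. char (distr S borel (T n)) t - char \<kappa> t) \<longlonglongrightarrow> 0"
      using Lim_null_comparison[OF always_eventually[OF allI[OF bound]]] by simp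
    then show "(\<lambda>n. char (distr S borel (T n)) t) \<longlonglongrightarrow> char \<kappa> t" by (rule LIM_zero_cancel)
  qed (rule D.real_distribution_axioms, rule \<kappa>.real_distribution_axioms)
qed

section \<open>Almost sure convergence of the backward iterates\<close>

definition slope :: "nat \<Rightarrow> 's \<Rightarrow> real" where
  "slope n \<omega> = (\<Prod>k<n. P (Suc k) \<omega>)"

text \<open>Partial sum of the perpetuity series
  \<open>Q 1 + P 1 * Q 2 + P 1 * P 2 * Q 3 + ...\<close>, which is the value of the backward iterate
  at \<open>0\<close>.\<close>

definition offset :: "nat \<Rightarrow> 's \<Rightarrow> real" where
  "offset n \<omega> = (\<Sum>k<n. slope k \<omega> * Q (Suc k) \<omega>)"

lemma backward_iter_affine:
  assumes "\<And>n. F n = (\<lambda>x. P n \<omega> * x + Q n \<omega>)"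
  shows "backward_iter F n x = offset n \<omega> + slope n \<omega> * x"
  by (induction n arbitrary: x) (simp_all add: assms offset_def slope_def algebra_simps)

lemma slope_measurable [measurable]: "slope n \<in> borel_measurable S"
  unfolding slope_def by measurable

lemma offset_measurable [measurable]: "offset n \<in> borel_measurable S"
  unfolding offset_def by measurable

text \<open>Although a backward iterate takes its new map on the inside, its pair of offset and
  slope is updated by a forward recursion in that map. Hence \<open>recursion_law\<close> applies to
  the pair.\<close>

lemma joint_law:
  "distr S ((borel \<Otimes>\<^sub>M borel) \<Otimes>\<^sub>M (borel \<Otimes>\<^sub>M borel)) (\<lambda>\<omega>. ((offset n \<omega>, slope n \<omega>), P (Suc n) \<omega>, Q (Suc n) \<omega>)) =
     distr S (borel \<Otimes>\<^sub>M borel) (\<lambda>\<omega>. (offset n \<omega>, slope n \<omega>)) \<Otimes>\<^sub>M \<Lambda>"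
proof -
  let ?H = "\<lambda>s w. (fst s + snd s * snd w, snd s * fst w) :: real \<times> real"
  have "case_prod ?H \<in> (borel \<Otimes>\<^sub>M borel) \<Otimes>\<^sub>M (borel \<Otimes>\<^sub>M borel) \<rightarrow>\<^sub>M borel \<Otimes>\<^sub>M borel"
    unfolding split_beta' by measurable
  from S.recursion_law(2)[OF indep_PQ this, of "(0, 1)" "\<lambda>n \<omega>. (offset n \<omega>, slope n \<omega>)" n]
  show ?thesis
    using law_PQ[of "Suc n"] by (simp add: space_pair_measure offset_def slope_def)
qed

text \<open>Conditioning on the first \<open>n\<close> maps: by independence the next map may be
  averaged out separately.\<close>

lemma integral_step:
  fixes f :: "real \<Rightarrow> real \<Rightarrow> real \<Rightarrow> real \<Rightarrow> complex"
  assumes [measurable]: "(\<lambda>((u, v), c, q). f u v c q) \<in> borel_measurable ((borel \<Otimes>\<^sub>M borel) \<Otimes>\<^sub>M (borel \<Otimes>\<^sub>M borel))"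
    and bdd: "\<And>u v c q. cmod (f u v c q) \<le> 1"
  shows "(CLINT \<omega>|S. f (offset n \<omega>) (slope n \<omega>) (P (Suc n) \<omega>) (Q (Suc n) \<omega>)) =
    (CLINT \<omega>|S. CLINT w|\<Lambda>. f (offset n \<omega>) (slope n \<omega>) (fst w) (snd w))"
proof -
  let ?D = "distr S (borel \<Otimes>\<^sub>M borel) (\<lambda>\<omega>. (offset n \<omega>, slope n \<omega>))"
  let ?g = "\<lambda>s w. f (fst s) (snd s) (fst w) (snd w)"
  have g[measurable]: "case_prod ?g \<in> borel_measurable ((borel \<Otimes>\<^sub>M borel) \<Otimes>\<^sub>M (borel \<Otimes>\<^sub>M borel))"
    using assms(1) by (simp add: split_beta')
  have m: "(\<lambda>s. CLINT w|\<Lambda>. ?g s w) \<in> borel_measurable (borel \<Otimes>\<^sub>M borel)"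
    by (rule borel_measurable_lebesgue_integral) measurable
  interpret D: prob_space ?D by (rule S.prob_space_distr) measurable
  interpret pair_prob_space ?D \<Lambda> ..
  have int: "integrable (?D \<Otimes>\<^sub>M \<Lambda>) (case_prod ?g)"
    by (rule integrable_const_bound[of _ 1]) (use bdd in \<open>auto simp: split_beta'\<close>)
  have "(CLINT \<omega>|S. f (offset n \<omega>) (slope n \<omega>) (P (Suc n) \<omega>) (Q (Suc n) \<omega>)) =
     (CLINT z|?D \<Otimes>\<^sub>M \<Lambda>. case_prod ?g z)"
    unfolding joint_law[symmetric] by (subst integral_distr) simp_all
  also have "\<dots> = (CLINT s|?D. CLINT w|\<Lambda>. ?g s w)"
    using integral_fst[OF int] by simp
  also have "\<dots> = (CLINT \<omega>|S. CLINT w|\<Lambda>. f (offset n \<omega>) (slope n \<omega>) (fst w) (snd w))"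
    by (subst integral_distr[OF _ m]) simp_all
  finally show ?thesis .
qed

text \<open>Inserting an independent \<open>\<kappa>\<close>-distributed value into a backward iterate leaves its law equal
  to \<open>\<kappa>\<close>.\<close>
lemma char_invariant:
  "(CLINT \<omega>|S. iexp (t * offset n \<omega>) * char \<kappa> (t * slope n \<omega>)) = char \<kappa> t"
proof (induction n)
  case 0
  show ?case by (simp add: offset_def slope_def S.prob_space)
next
  case (Suc n)
  let ?f = "\<lambda>u v c q. iexp (t * (u + v * q)) * char \<kappa> (t * (v * c))"
  have f: "iexp (t * u) * (iexp (t * v * snd w) * char \<kappa> (t * v * fst w)) = ?f u v (fst w) (snd w)" for u v w
    unfolding mult.assoc[symmetric] exp_add[symmetric] by (simp add: algebra_simps)
  have "(CLINT \<omega>|S. iexp (t * offset (Suc n) \<omega>) * char \<kappa> (t * slope (Suc n) \<omega>)) =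
    (CLINT \<omega>|S. ?f (offset n \<omega>) (slope n \<omega>) (P (Suc n) \<omega>) (Q (Suc n) \<omega>))"
    by (simp add: offset_def slope_def)
  also have "\<dots> = (CLINT \<omega>|S. CLINT w|\<Lambda>. ?f (offset n \<omega>) (slope n \<omega>) (fst w) (snd w))"
    by (rule integral_step) (simp_all add: norm_mult \<kappa>.cmod_char_le_1 split_beta')
  \<comment> \<open>For fixed \<open>\<omega>\<close> this is the functional equation of
    \<open>char \<kappa>\<close> at \<open>t * slope n \<omega>\<close>, which absorbs the average
    over the newest map.\<close>
  also have "\<dots> = (CLINT \<omega>|S. iexp (t * offset n \<omega>) * char \<kappa> (t * slope n \<omega>))"
    by (intro Bochner_Integration.integral_cong refl, subst char_solution) (simp only: f integral_mult_right_zero[symmetric])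
  finally show ?case using Suc by simp
qed

text \<open>The slope after \<open>n\<close> maps is independent of map \<open>Suc n\<close>, so
  expectations multiply. With nonnegative integrals no integrability has to be checked; both claims
  are instances of the factorisation \<open>mult\<close>.\<close>

lemma nn_integral_slope: "(\<integral>\<^sup>+\<omega>. ennreal \<bar>slope n \<omega>\<bar> \<partial>S) = (\<integral>\<^sup>+w. ennreal \<bar>fst w\<bar> \<partial>\<Lambda>) ^ n"
  and nn_integral_slope_mult: "g \<in> borel_measurable borel \<Longrightarrow>
    (\<integral>\<^sup>+\<omega>. ennreal \<bar>slope n \<omega>\<bar> * g (Q (Suc n) \<omega>) \<partial>S) =
      (\<integral>\<^sup>+\<omega>. ennreal \<bar>slope n \<omega>\<bar> \<partial>S) * (\<integral>\<^sup>+w. g (snd w) \<partial>\<Lambda>)"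
proof -
  let ?D = "\<lambda>n. distr S (borel \<Otimes>\<^sub>M borel) (\<lambda>\<omega>. (offset n \<omega>, slope n \<omega>))"
  interpret D: prob_space "?D n" for n by (rule S.prob_space_distr) measurable
  have mult: "(\<integral>\<^sup>+\<omega>. ennreal \<bar>slope n \<omega>\<bar> * h (P (Suc n) \<omega>, Q (Suc n) \<omega>) \<partial>S) =
      (\<integral>\<^sup>+\<omega>. ennreal \<bar>slope n \<omega>\<bar> \<partial>S) * (\<integral>\<^sup>+w. h w \<partial>\<Lambda>)"
    if [measurable]: "h \<in> borel_measurable (borel \<Otimes>\<^sub>M borel)" for h :: "real \<times> real \<Rightarrow> ennreal" and n
  proof -
    have "(\<integral>\<^sup>+\<omega>. ennreal \<bar>slope n \<omega>\<bar> * h (P (Suc n) \<omega>, Q (Suc n) \<omega>) \<partial>S) =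
        (\<integral>\<^sup>+z. ennreal \<bar>snd (fst z)\<bar> * h (snd z) \<partial>(?D n \<Otimes>\<^sub>M \<Lambda>))"
      unfolding joint_law[symmetric] by (subst nn_integral_distr) simp_all
    also have "\<dots> = (\<integral>\<^sup>+s. \<integral>\<^sup>+w. ennreal \<bar>snd s\<bar> * h w \<partial>\<Lambda> \<partial>?D n)"
      by (subst nn_integral_fst[symmetric]) simp_all
    also have "\<dots> = (\<integral>\<^sup>+s. ennreal \<bar>snd s\<bar> * (\<integral>\<^sup>+w. h w \<partial>\<Lambda>) \<partial>?D n)"
      by (subst nn_integral_cmult) simp_all
    also have "\<dots> = (\<integral>\<^sup>+s. ennreal \<bar>snd s\<bar> \<partial>?D n) * (\<integral>\<^sup>+w. h w \<partial>\<Lambda>)"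
      by (subst nn_integral_multc) simp_all
    also have "(\<integral>\<^sup>+s. ennreal \<bar>snd s\<bar> \<partial>?D n) = (\<integral>\<^sup>+\<omega>. ennreal \<bar>slope n \<omega>\<bar> \<partial>S)"
      by (subst nn_integral_distr) simp_all
    finally show ?thesis .
  qed
  show "(\<integral>\<^sup>+\<omega>. ennreal \<bar>slope n \<omega>\<bar> \<partial>S) = (\<integral>\<^sup>+w. ennreal \<bar>fst w\<bar> \<partial>\<Lambda>) ^ n"
  proof (induction n)
    case 0
    show ?case by (simp add: slope_def S.emeasure_space_1)
  next
    case (Suc n)
    have "(\<integral>\<^sup>+\<omega>. ennreal \<bar>slope (Suc n) \<omega>\<bar> \<partial>S) = (\<integral>\<^sup>+\<omega>. ennreal \<bar>slope n \<omega>\<bar> * ennreal \<bar>P (Suc n) \<omega>\<bar> \<partial>S)"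
      by (simp add: slope_def abs_mult ennreal_mult)
    then show ?case using mult[of "\<lambda>w. ennreal \<bar>fst w\<bar>" n] by (simp add: Suc mult.commute)
  qed
  show "(\<integral>\<^sup>+\<omega>. ennreal \<bar>slope n \<omega>\<bar> * g (Q (Suc n) \<omega>) \<partial>S) =
      (\<integral>\<^sup>+\<omega>. ennreal \<bar>slope n \<omega>\<bar> \<partial>S) * (\<integral>\<^sup>+w. g (snd w) \<partial>\<Lambda>)" if [measurable]: "g \<in> borel_measurable borel"
    using mult[of "\<lambda>w. g (snd w)" n] by simp
qed

text \<open>The terms have expectation \<open>\<rho> ^ n * c\<close>, so the expected sum is finite.
  The weight \<open>1 + \<bar>Q (Suc n) \<omega>\<bar>\<close> dominates both the slopes and the
  terms of the offset series.\<close>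

lemma AE_summable_slope:
  assumes int: "integrable \<Lambda> snd"
  shows "AE \<omega> in S. summable (\<lambda>n. \<bar>slope n \<omega>\<bar> * (1 + \<bar>Q (Suc n) \<omega>\<bar>))"
proof -
  define \<rho> where "\<rho> = (\<integral>w. fst w \<partial>\<Lambda>)"
  have \<rho>: "0 \<le> \<rho>" "\<rho> < 1" using slope_mean slope_range by (auto simp: \<rho>_def intro!: integral_nonneg_AE)
  have "(\<integral>\<^sup>+w. ennreal \<bar>fst w\<bar> \<partial>\<Lambda>) = (\<integral>\<^sup>+w. ennreal (fst w) \<partial>\<Lambda>)"
    by (rule nn_integral_cong_AE) (use slope_range in eventually_elim, simp)
  also have "\<dots> = ennreal \<rho>"
    unfolding \<rho>_def by (rule nn_integral_eq_integral[OF integrable_slope]) (use slope_range in auto)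
  finally have E: "(\<integral>\<^sup>+w. ennreal \<bar>fst w\<bar> \<partial>\<Lambda>) = ennreal \<rho>" .
  define c where "c = (\<integral>w. 1 + \<bar>snd w\<bar> \<partial>\<Lambda>)"
  have c: "(\<integral>\<^sup>+w. ennreal (1 + \<bar>snd w\<bar>) \<partial>\<Lambda>) = ennreal c" "c \<ge> 0"
    unfolding c_def by (rule nn_integral_eq_integral) (use int in \<open>auto intro!: integral_nonneg_AE\<close>)
  have "(\<integral>\<^sup>+\<omega>. ennreal (\<bar>slope n \<omega>\<bar> * (1 + \<bar>Q (Suc n) \<omega>\<bar>)) \<partial>S) = ennreal (\<rho> ^ n * c)" for n
    using nn_integral_slope_mult[of "\<lambda>q. ennreal (1 + \<bar>q\<bar>)" n] c \<rho>
    by (simp add: ennreal_mult nn_integral_slope E ennreal_power)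
  then have "(\<integral>\<^sup>+\<omega>. (\<Sum>n. ennreal (\<bar>slope n \<omega>\<bar> * (1 + \<bar>Q (Suc n) \<omega>\<bar>))) \<partial>S) = (\<Sum>n. ennreal (\<rho> ^ n * c))"
    by (subst nn_integral_suminf) simp_all
  also have "\<dots> < \<infinity>"
  proof -
    have "summable (\<lambda>n. \<rho> ^ n * c)" using \<rho> by (intro summable_mult2 summable_geometric) simp
    then show ?thesis
      using \<rho> c by (subst suminf_ennreal2) auto
  qed
  finally have "AE \<omega> in S. (\<Sum>n. ennreal (\<bar>slope n \<omega>\<bar> * (1 + \<bar>Q (Suc n) \<omega>\<bar>))) \<noteq> \<infinity>"
    by (intro nn_integral_PInf_AE) auto
  then show ?thesis
    by eventually_elim (intro summable_suminf_not_top, auto)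
qed

text \<open>Summability yields both limits. The law of the limit follows by dominated convergence in
  \<open>char_invariant\<close>: as the slope tends to \<open>0\<close>, the factor
  \<open>char \<kappa> (t * slope n \<omega>)\<close> tends to \<open>1\<close>.\<close>

lemma backward_limit:
  assumes int: "integrable \<Lambda> snd"
  obtains Y where "Y \<in> borel_measurable S" "distr S borel Y = \<kappa>"
    "AE \<omega> in S. (\<lambda>n. offset n \<omega>) \<longlonglongrightarrow> Y \<omega>" "AE \<omega> in S. (\<lambda>n. slope n \<omega>) \<longlonglongrightarrow> 0"
proof -
  have slope0: "AE \<omega> in S. (\<lambda>n. slope n \<omega>) \<longlonglongrightarrow> 0"
    using AE_summable_slope[OF int]
  proof eventually_elim
    case (elim \<omega>)
    have "summable (\<lambda>n. slope n \<omega>)"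
      by (rule summable_comparison_test'[OF elim, of 0]) (simp add: mult_le_cancel_left1)
    then show ?case by (rule summable_LIMSEQ_zero)
  qed
  \<comment> \<open>\<open>lim\<close> is total, so \<open>Y\<close> is measurable on all of
    \<open>S\<close>; it is the limit of the offsets wherever they converge.\<close>
  define Y where "Y \<omega> = lim (\<lambda>n. offset n \<omega>)" for \<omega>
  have Y[measurable]: "Y \<in> borel_measurable S" unfolding Y_def by measurable
  have conv: "AE \<omega> in S. (\<lambda>n. offset n \<omega>) \<longlonglongrightarrow> Y \<omega>"
    using AE_summable_slope[OF int]
  proof eventually_elim
    case (elim \<omega>)
    have "summable (\<lambda>n. slope n \<omega> * Q (Suc n) \<omega>)"
      by (rule summable_comparison_test'[OF elim, of 0]) (auto simp: abs_mult intro!: mult_left_mono)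
    then have "convergent (\<lambda>n. offset n \<omega>)" by (simp add: offset_def summable_iff_convergent)
    then show ?case by (simp add: Y_def convergent_LIMSEQ_iff)
  qed
  \<comment> \<open>Two limits of one sequence are compared: it is constant by invariance, and it
    converges to the characteristic function of \<open>Y\<close>.\<close>
  have "char (distr S borel Y) t = char \<kappa> t" for t
  proof (rule LIMSEQ_unique)
    show "(\<lambda>n. CLINT \<omega>|S. iexp (t * offset n \<omega>) * char \<kappa> (t * slope n \<omega>)) \<longlonglongrightarrow> char \<kappa> t"
      by (simp only: char_invariant tendsto_const)
    have "(\<lambda>n. CLINT \<omega>|S. iexp (t * offset n \<omega>) * char \<kappa> (t * slope n \<omega>)) \<longlonglongrightarrow> (CLINT \<omega>|S. iexp (t * Y \<omega>))"
    proof (rule integral_dominated_convergence[where w="\<lambda>_. 1"])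
      show "AE \<omega> in S. (\<lambda>n. iexp (t * offset n \<omega>) * char \<kappa> (t * slope n \<omega>)) \<longlonglongrightarrow> iexp (t * Y \<omega>)"
        using conv slope0
      proof eventually_elim
        case (elim \<omega>)
        have "(\<lambda>n. char \<kappa> (t * slope n \<omega>)) \<longlonglongrightarrow> char \<kappa> (t * 0)"
          by (rule isCont_tendsto_compose[OF \<kappa>.isCont_char]) (intro tendsto_intros elim)
        moreover have "(\<lambda>n. iexp (t * offset n \<omega>)) \<longlonglongrightarrow> iexp (t * Y \<omega>)"
          by (intro tendsto_intros elim)
        ultimately show ?case using tendsto_mult \<kappa>.char_zero by fastforce
      qed
    qed (simp_all add: norm_mult \<kappa>.cmod_char_le_1)
    then show "(\<lambda>n. CLINT \<omega>|S. iexp (t * offset n \<omega>) * char \<kappa> (t * slope n \<omega>)) \<longlonglongrightarrow> char (distr S borel Y) t"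
      by (simp add: char_def integral_distr)
  qed
  then have "distr S borel Y = \<kappa>"
    by (intro Levy_uniqueness S.real_distribution_distr \<kappa>.real_distribution_axioms ext Y)
  then show ?thesis using that Y conv slope0 by blast
qed

text \<open>For \<open>x\<close> in \<open>[0, 1]\<close> the affine iterate differs from
  \<open>Y\<close> by at most \<open>\<bar>offset n \<omega> - Y \<omega>\<bar> + \<bar>slope n
  \<omega>\<bar>\<close>, a bound free of \<open>x\<close>.\<close>

lemma backward_uniform_limit:
  assumes int: "integrable \<Lambda> snd" and F: "\<And>\<omega> n. F \<omega> n = (\<lambda>x. P n \<omega> * x + Q n \<omega>)"
  shows "\<exists>Y \<in> borel_measurable S. distr S borel Y = \<kappa> \<and>
    (AE \<omega> in S. uniform_limit {0..1} (\<lambda>n x. backward_iter (F \<omega>) n x) (\<lambda>_. Y \<omega>) sequentially)"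
proof -
  obtain Y where Y: "Y \<in> borel_measurable S" "distr S borel Y = \<kappa>"
    and conv: "AE \<omega> in S. (\<lambda>n. offset n \<omega>) \<longlonglongrightarrow> Y \<omega>" "AE \<omega> in S. (\<lambda>n. slope n \<omega>) \<longlonglongrightarrow> 0"
    using backward_limit[OF int] by blast
  from conv have "AE \<omega> in S. uniform_limit {0..1} (\<lambda>n x. backward_iter (F \<omega>) n x) (\<lambda>_. Y \<omega>) sequentially"
  proof eventually_elim
    case (elim \<omega>)
    have "(\<lambda>n. \<bar>offset n \<omega> - Y \<omega>\<bar> + \<bar>slope n \<omega>\<bar>) \<longlonglongrightarrow> 0"
      using tendsto_add[OF tendsto_rabs[OF LIM_zero[OF elim(1)]] tendsto_rabs[OF elim(2)]] by simp
    show ?case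
    proof (rule uniform_limitI)
      fix e :: real assume "e > 0"
      have "eventually (\<lambda>n. \<bar>offset n \<omega> - Y \<omega>\<bar> + \<bar>slope n \<omega>\<bar> < e) sequentially"
        by (rule order_tendstoD(2)) fact+
      then show "\<forall>\<^sub>F n in sequentially. \<forall>x\<in>{0..1}. dist (backward_iter (F \<omega>) n x) (Y \<omega>) < e"
      proof eventually_elim
        case (elim n)
        show ?case
        proof
          fix x :: real assume x: "x \<in> {0..1}"
          have "\<bar>slope n \<omega> * x\<bar> \<le> \<bar>slope n \<omega>\<bar>" using x by (simp add: abs_mult mult_left_le)
          then show "dist (backward_iter (F \<omega>) n x) (Y \<omega>) < e"
            using elim unfolding dist_real_def backward_iter_affine[OF F] by linarith
        qed
      qed
    qed
  qed
  with Y show ?thesis by blast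
qed

end

section \<open>The mixture representation of the driving law\<close>

text \<open>Mapping both elements into one value type makes the product rule for
  \<open>indep_var\<close> available. Preimages under the composites are preimages under
  \<open>X\<close> and \<open>Y\<close>, and these families are closed under intersection.\<close>

lemma (in prob_space) indep_elements_imp_indep_var:
  assumes ind: "indep_elements M N X N' Y"
    and f[measurable]: "f \<in> N \<rightarrow>\<^sub>M K" and g[measurable]: "g \<in> N' \<rightarrow>\<^sub>M K'"
  shows "indep_var K (\<lambda>\<omega>. f (X \<omega>)) K' (\<lambda>\<omega>. g (Y \<omega>))"
proof -
  have X[measurable]: "X \<in> M \<rightarrow>\<^sub>M N" and Y[measurable]: "Y \<in> M \<rightarrow>\<^sub>M N'"
    and XY: "indep_set {X -` U \<inter> space M |U. U \<in> sets N} {Y -` U \<inter> space M |U. U \<in> sets N'}"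
    using ind by (auto simp: indep_elements_def)
  have stable: "Int_stable {h -` A \<inter> space M |A. A \<in> sets R}" for h :: "'a \<Rightarrow> 'z" and R
  proof (safe intro!: Int_stableI)
    fix A B assume "A \<in> sets R" "B \<in> sets R"
    then show "\<exists>C. (h -` A \<inter> space M) \<inter> (h -` B \<inter> space M) = (h -` C \<inter> space M) \<and> C \<in> sets R"
      by (intro exI[of _ "A \<inter> B"]) auto
  qed
  have f_vim: "(\<lambda>\<omega>. f (X \<omega>)) -` A \<inter> space M = X -` (f -` A \<inter> space N) \<inter> space M" for A
    using measurable_space[OF X] by auto
  have g_vim: "(\<lambda>\<omega>. g (Y \<omega>)) -` A \<inter> space M = Y -` (g -` A \<inter> space N') \<inter> space M" for A
    using measurable_space[OF Y] by auto
  show ?thesis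
    unfolding indep_var_eq
  proof (intro conjI indep_set_sigma_sets stable)
    show "indep_set {(\<lambda>\<omega>. f (X \<omega>)) -` A \<inter> space M |A. A \<in> sets K}
        {(\<lambda>\<omega>. g (Y \<omega>)) -` A \<inter> space M |A. A \<in> sets K'}"
    proof (rule indep_setI)
      fix a b
      assume "a \<in> {(\<lambda>\<omega>. f (X \<omega>)) -` A \<inter> space M |A. A \<in> sets K}"
        and "b \<in> {(\<lambda>\<omega>. g (Y \<omega>)) -` A \<inter> space M |A. A \<in> sets K'}"
      then show "prob (a \<inter> b) = prob a * prob b"
        unfolding f_vim g_vim using measurable_sets[OF f] measurable_sets[OF g]
        by (intro indep_setD[OF XY]) blast+
    qed auto
  qed measurable
qed

definition beta_density :: "real \<Rightarrow> real \<Rightarrow> real \<Rightarrow> real" where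
  "beta_density a b u = indicator {0<..<1} u * (u powr (a - 1) * (1 - u) powr (b - 1) / Beta a b)"

lemma beta_density_measurable [measurable]: "beta_density a b \<in> borel_measurable borel"
  unfolding beta_density_def by measurable

lemma beta_density_nonneg: "a > 0 \<Longrightarrow> b > 0 \<Longrightarrow> beta_density a b u \<ge> 0"
  unfolding beta_density_def Beta_def by (auto simp: indicator_def Gamma_real_nonneg)

text \<open>The factors come from the recurrence of the Beta function when one argument grows by
  \<open>1\<close>. With \<open>a = y\<close> and \<open>b = z\<close> the left sides are the
  densities of \<open>1 - L\<close> and \<open>R\<close> weighted by \<open>p\<close> and
  \<open>1 - p\<close>; the right sides rewrite them with one density and branch weights
  \<open>u\<close> and \<open>1 - u\<close>.\<close>

lemma beta_density_shift:
  assumes "a > 0" "b > 0"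
  shows "a / (a + b) * beta_density b (a + 1) (1 - u) = u * beta_density a b u"
    and "b / (a + b) * beta_density a (b + 1) u = (1 - u) * beta_density a b u"
proof -
  have nz: "a \<notin> \<int>\<^sub>\<le>\<^sub>0" "b \<notin> \<int>\<^sub>\<le>\<^sub>0" using assms by (auto elim!: nonpos_Ints_cases)
  have pos: "Beta a b > 0" using assms by (simp add: Beta_def Gamma_real_pos)
  have b1: "Beta a (b + 1) = b / (a + b) * Beta a b" and b2: "Beta b (a + 1) = a / (a + b) * Beta a b"
    using Beta_plus1_right[OF nz(2), of a] Beta_plus1_left[OF nz(1), of b] assms
    by (simp_all add: field_simps Beta_commute[of b])
  have cancel: "c / (a + b) * (v / (c / (a + b) * Beta a b)) = v / Beta a b" if "c > 0" for c v
    using that assms pos by (simp add: divide_simps)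
  show "a / (a + b) * beta_density b (a + 1) (1 - u) = u * beta_density a b u"
  proof (cases "u \<in> {0<..<1}")
    case True
    then have "u powr a = u * u powr (a - 1)" using powr_mult_base[of u "a - 1"] by simp
    with True show ?thesis
      using assms by (simp add: beta_density_def b2 cancel del: times_divide_eq_left times_divide_eq_right)
        (simp add: mult_ac)
  qed (auto simp: beta_density_def)
  show "b / (a + b) * beta_density a (b + 1) u = (1 - u) * beta_density a b u"
  proof (cases "u \<in> {0<..<1}")
    case True
    then have "(1 - u) powr b = (1 - u) * (1 - u) powr (b - 1)" using powr_mult_base[of "1 - u" "b - 1"] by simp
    with True show ?thesis
      using assms by (simp add: beta_density_def b1 cancel del: times_divide_eq_left times_divide_eq_right)
        (simp add: mult_ac)
  qed (auto simp: beta_density_def)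
qed

lemma beta_law_integral:
  fixes f :: "real \<Rightarrow> 'b::{banach, second_countable_topology}"
  assumes "a > 0" "b > 0" and [measurable]: "f \<in> borel_measurable borel"
  shows "(\<integral>u. f u \<partial>beta_law a b) = (\<integral>u. beta_density a b u *\<^sub>R f u \<partial>lborel)"
    and "integrable (beta_law a b) f \<longleftrightarrow> integrable lborel (\<lambda>u. beta_density a b u *\<^sub>R f u)"
  unfolding beta_law_def beta_density_def[symmetric]
  by (subst integral_density integrable_density; use assms in \<open>auto simp: beta_density_nonneg\<close>)+

text \<open>Splitting on the coin leaves one summand in \<open>L\<close> and one in
  \<open>R\<close>. The coin is independent of the pair and factors out, and then only the marginal
  laws of \<open>L\<close> and \<open>R\<close> enter, whatever their dependence.\<close>

lemma integral_mixture:
  fixes f :: "real \<times> real \<Rightarrow> complex"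
  assumes yz: "y > 0" "z > 0" "p = y / (y + z)" and M: "prob_space M"
    and Ip: "distr M (count_space UNIV) Ip = measure_pmf (bernoulli_pmf p)"
    and ind: "indep_elements M (count_space UNIV) Ip (borel \<Otimes>\<^sub>M borel) (\<lambda>\<omega>. (L \<omega>, R \<omega>))"
    and L: "distr M borel L = beta_law z (y + 1)"
    and R: "distr M borel R = beta_law y (z + 1)"
    and f[measurable]: "f \<in> borel_measurable (borel \<Otimes>\<^sub>M borel)" and bdd: "\<And>w. norm (f w) \<le> C"
  shows "(CLINT w|distr M (borel \<Otimes>\<^sub>M borel)
           (\<lambda>\<omega>. of_bool (Ip \<omega>) *\<^sub>R (1 - L \<omega>, 0) + (1 - of_bool (Ip \<omega>)) *\<^sub>R (1, R \<omega>)). f w) =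
    (CLINT w|lborel. beta_density y z w *\<^sub>R (w *\<^sub>R f (w, 0) + (1 - w) *\<^sub>R f (1, w)))"
proof -
  interpret prob_space M by fact
  have [measurable]: "Ip \<in> M \<rightarrow>\<^sub>M count_space UNIV"
    and LR: "(\<lambda>\<omega>. (L \<omega>, R \<omega>)) \<in> M \<rightarrow>\<^sub>M borel \<Otimes>\<^sub>M borel"
    using ind by (auto simp: indep_elements_def)
  have [measurable]: "L \<in> borel_measurable M" "R \<in> borel_measurable M"
    using measurable_compose[OF LR measurable_fst] measurable_compose[OF LR measurable_snd] by simp_all
  have p: "0 \<le> p" "p \<le> 1" "1 - p = z / (y + z)" using yz(1,2) by (simp_all add: yz(3) field_simps)
  have EI: "(CLINT \<omega>|M. of_bool (Ip \<omega>)) = of_real p" "(CLINT \<omega>|M. 1 - of_bool (Ip \<omega>)) = of_real (1 - p)"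
  proof -
    have "(CLINT \<omega>|M. complex_of_real (h (Ip \<omega>))) = of_real (\<integral>b. h b \<partial>measure_pmf (bernoulli_pmf p))" for h :: "bool \<Rightarrow> real"
      unfolding Ip[symmetric] by (subst integral_distr) simp_all
    note E = this
    have c: "(of_bool b :: complex) = of_real (of_bool b)" "(1 - of_bool b :: complex) = of_real (1 - of_bool b)" for b
      by (cases b; simp)+
    show "(CLINT \<omega>|M. of_bool (Ip \<omega>)) = of_real p"
      unfolding c(1) E using p(1,2) by simp
    show "(CLINT \<omega>|M. 1 - of_bool (Ip \<omega>)) = of_real (1 - p)"
      unfolding c(2) E[of "\<lambda>b. 1 - of_bool b"] using p(1,2) by simp
  qed
  let ?f1 = "\<lambda>\<omega>. of_bool (Ip \<omega>) * f (1 - L \<omega>, 0)" and ?f2 = "\<lambda>\<omega>. (1 - of_bool (Ip \<omega>)) * f (1, R \<omega>)"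
  have C: "0 \<le> C" using bdd[of "(0,0)"] norm_ge_zero order_trans by blast
  have bd: "integrable M h" if "h \<in> borel_measurable M" "\<And>\<omega>. cmod (h \<omega>) \<le> c" for h c
    using that by (intro integrable_const_bound[of _ c]) auto
  have int: "integrable M ?f1" "integrable M ?f2"
    using C bdd by (auto intro!: bd[of _ C])
  have p1: "(CLINT \<omega>|M. ?f1 \<omega>) = of_real p * (CLINT \<omega>|M. f (1 - L \<omega>, 0))"
    unfolding EI[symmetric]
    by (intro indep_var_lebesgue_integral
        indep_elements_imp_indep_var[OF ind, of of_bool borel "\<lambda>(l, r). f (1 - l, 0)" borel, simplified])
      (auto intro!: bd[of _ 1] bd[OF _ bdd])
  have p2: "(CLINT \<omega>|M. ?f2 \<omega>) = of_real (1 - p) * (CLINT \<omega>|M. f (1, R \<omega>))"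
    unfolding EI[symmetric]
    by (intro indep_var_lebesgue_integral
        indep_elements_imp_indep_var[OF ind, of "\<lambda>b. 1 - of_bool b" borel "\<lambda>(l, r). f (1, r)" borel, simplified])
      (auto intro!: bd[of _ 1] bd[OF _ bdd])
  have intL: "integrable (beta_law z (y + 1)) (\<lambda>l. f (1 - l, 0))"
    unfolding L[symmetric] by (subst integrable_distr_eq) (auto intro!: bd[OF _ bdd])
  have intR: "integrable (beta_law y (z + 1)) (\<lambda>r. f (1, r))"
    unfolding R[symmetric] by (subst integrable_distr_eq) (auto intro!: bd[OF _ bdd])
  have sL: "p *\<^sub>R (beta_density z (y + 1) (1 - w) *\<^sub>R f (1 - (1 - w), 0)) = beta_density y z w *\<^sub>R (w *\<^sub>R f (w, 0))" for w
    using beta_density_shift(1)[OF yz(1,2), of w] by (simp add: yz(3) mult.commute)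
  have sR: "(1 - p) *\<^sub>R (beta_density y (z + 1) w *\<^sub>R f (1, w)) = beta_density y z w *\<^sub>R ((1 - w) *\<^sub>R f (1, w))" for w
    using beta_density_shift(2)[OF yz(1,2), of w] by (simp add: p(3) mult.commute)
  have "integrable lborel (\<lambda>l. beta_density z (y + 1) l *\<^sub>R f (1 - l, 0))"
    using intL yz by (subst (asm) beta_law_integral) auto
  \<comment> \<open>The substitution \<open>l = 1 - w\<close> passes from \<open>L\<close> to the
    first coordinate \<open>1 - L\<close>.\<close>
  from lborel_integrable_real_affine[OF this, of "-1" 1]
  have iL: "integrable lborel (\<lambda>w. beta_density z (y + 1) (1 - w) *\<^sub>R f (1 - (1 - w), 0))"
    by simp
  have iR: "integrable lborel (\<lambda>r. beta_density y (z + 1) r *\<^sub>R f (1, r))"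
    using intR yz by (subst (asm) beta_law_integral) auto
  have "of_real p * (CLINT \<omega>|M. f (1 - L \<omega>, 0)) = p *\<^sub>R (CLINT l|beta_law z (y + 1). f (1 - l, 0))"
    unfolding L[symmetric] by (subst integral_distr) (auto simp: scaleR_conv_of_real)
  also have "\<dots> = p *\<^sub>R (CLINT l|lborel. beta_density z (y + 1) l *\<^sub>R f (1 - l, 0))"
    using yz by (subst beta_law_integral) auto
  also have "\<dots> = p *\<^sub>R (CLINT w|lborel. beta_density z (y + 1) (1 - w) *\<^sub>R f (1 - (1 - w), 0))"
    by (subst lborel_integral_real_affine[of "-1" _ 1]) simp_all
  also have "\<dots> = (CLINT w|lborel. beta_density y z w *\<^sub>R (w *\<^sub>R f (w, 0)))"
    by (simp only: integral_scaleR_right[symmetric] sL)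
  finally have eL: "of_real p * (CLINT \<omega>|M. f (1 - L \<omega>, 0)) = \<dots>" .
  have "of_real (1 - p) * (CLINT \<omega>|M. f (1, R \<omega>)) = (1 - p) *\<^sub>R (CLINT r|beta_law y (z + 1). f (1, r))"
    unfolding R[symmetric] by (subst integral_distr) (auto simp: scaleR_conv_of_real)
  also have "\<dots> = (1 - p) *\<^sub>R (CLINT r|lborel. beta_density y (z + 1) r *\<^sub>R f (1, r))"
    using yz by (subst beta_law_integral) auto
  also have "\<dots> = (CLINT w|lborel. beta_density y z w *\<^sub>R ((1 - w) *\<^sub>R f (1, w)))"
    by (simp only: integral_scaleR_right[symmetric] sR)
  finally have eR: "of_real (1 - p) * (CLINT \<omega>|M. f (1, R \<omega>)) = \<dots>" .
  have "(CLINT w|distr M (borel \<Otimes>\<^sub>M borel)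
      (\<lambda>\<omega>. of_bool (Ip \<omega>) *\<^sub>R (1 - L \<omega>, 0) + (1 - of_bool (Ip \<omega>)) *\<^sub>R (1, R \<omega>)). f w) =
    (CLINT \<omega>|M. ?f1 \<omega> + ?f2 \<omega>)"
    by (subst integral_distr) (auto intro!: Bochner_Integration.integral_cong simp: of_bool_def)
  also have "\<dots> = (CLINT w|lborel. beta_density y z w *\<^sub>R (w *\<^sub>R f (w, 0))) +
      (CLINT w|lborel. beta_density y z w *\<^sub>R ((1 - w) *\<^sub>R f (1, w)))"
    using int by (simp only: Bochner_Integration.integral_add p1 p2 eL eR)
  also have "\<dots> = (CLINT w|lborel. beta_density y z w *\<^sub>R (w *\<^sub>R f (w, 0) + (1 - w) *\<^sub>R f (1, w)))"
    using integrable_scaleR_right[OF iL, of p] integrable_scaleR_right[OF iR, of "1 - p"]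
    unfolding sL sR scaleR_add_right by (intro Bochner_Integration.integral_add[symmetric]) auto
  finally show ?thesis .
qed

section \<open>The uniform and the exponential law\<close>

lemma beta_law_1_1: "beta_law 1 1 = density lborel (\<lambda>u. ennreal (indicator {0<..<1} u))"
proof -
  have "Gamma (2::real) = 1" using Gamma_fact[of 1, where 'a=real] by simp
  then show ?thesis
    unfolding beta_law_def by (intro density_cong) (auto simp: Beta_def indicator_def)
qed

lemma gamma_law_1: "gamma_law 1 = density lborel (\<lambda>u. ennreal (exponential_density 1 u))"
  unfolding gamma_law_def
proof (intro density_cong)
  show "AE u in lborel. ennreal (indicator {0<..} u * (u powr (1 - 1) * exp (- u) / Gamma 1)) =
      ennreal (exponential_density 1 u)"
    \<comment> \<open>The densities differ only at \<open>0\<close>, where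
      \<open>exponential_density\<close> is \<open>1\<close> and the indicator vanishes.\<close>
    using AE_lborel_singleton[of "0::real"]
    by eventually_elim (auto simp: exponential_density_def indicator_def)
qed simp_all

lemma real_distribution_uniform: "real_distribution (beta_law 1 1)"
proof -
  have "prob_space (beta_law 1 1)"
    unfolding beta_law_1_1 by (rule prob_spaceI) (simp add: emeasure_density ennreal_indicator)
  then show ?thesis by (simp add: real_distribution_def real_distribution_axioms_def beta_law_def)
qed

lemma real_distribution_exponential: "real_distribution (gamma_law 1)"
proof -
  have "prob_space (gamma_law 1)"
    unfolding gamma_law_1 by (rule prob_space_exponential_density) simp
  then show ?thesis by (simp add: real_distribution_def real_distribution_axioms_def gamma_law_def)
qed

lemma integrable_uniform: "integrable (beta_law 1 1) (\<lambda>x. x)"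
proof -
  interpret real_distribution "beta_law 1 1" by (rule real_distribution_uniform)
  have "AE x in beta_law 1 1. norm x \<le> 1"
    unfolding beta_law_1_1 by (subst AE_density) (auto simp: indicator_def)
  then show ?thesis by (intro integrable_const_bound[of _ 1]) auto
qed

lemma integrable_exponential: "integrable (gamma_law 1) (\<lambda>x. x)"
proof -
  interpret real_distribution "gamma_law 1" by (rule real_distribution_exponential)
  have "distributed (gamma_law 1) lborel (\<lambda>x. x) (exponential_density 1)"
    unfolding distributed_def gamma_law_1 by (auto intro!: distr_id2)
  \<comment> \<open>The exponential density is the Erlang density with parameter \<open>0\<close>,
    so this is its first moment.\<close>
  from has_bochner_integral_erlang_ith_moment[OF _ this, of 1] show ?thesis
    by (simp add: has_bochner_integral_iff)
qed

lemma char_uniform: "char (beta_law 1 1) t = (if t = 0 then 1 else (iexp t - 1) / (\<i> * t))"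
proof (cases "t = 0")
  case True
  then show ?thesis using real_distribution.char_zero[OF real_distribution_uniform] by simp
next
  case False
  have "char (beta_law 1 1) t = (CLINT x|lborel. indicator {0<..<1} x *\<^sub>R iexp (t * x))"
    unfolding char_def beta_law_1_1 by (subst integral_density) auto
  also have "\<dots> = (CLBINT x=(0::real)..(1::real). iexp (t * x))"
    by (simp add: interval_lebesgue_integral_def set_lebesgue_integral_def)
  also have "\<dots> = iexp (t * 1) / (\<i> * t) - iexp (t * 0) / (\<i> * t)"
  proof (rule interval_integral_FTC_finite)
    show "continuous_on {min 0 1..max 0 1} (\<lambda>x. iexp (t * x))" by (intro continuous_intros)
    have "((\<lambda>w. exp (\<i> * t * w) / (\<i> * t)) has_field_derivative exp (\<i> * t * of_real x)) (at (of_real x))" for x :: real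
      using False by (auto intro!: derivative_eq_intros)
    from has_vector_derivative_real_field[OF this]
    show "((\<lambda>x. iexp (t * x) / (\<i> * t)) has_vector_derivative iexp (t * x)) (at x within {min 0 1..max 0 1})" for x
      by (simp add: mult.assoc)
  qed
  finally show ?thesis using False by (simp add: diff_divide_distrib)
qed

text \<open>The integrand is \<open>exp (c * x)\<close> with \<open>c = \<i> * t - 1\<close>. As
  \<open>Re c = -1\<close>, the antiderivative \<open>exp (c * x) / c\<close> vanishes at infinity,
  and the value at \<open>0\<close> remains.\<close>

lemma char_exponential: "char (gamma_law 1) t = 1 / (1 - \<i> * t)"
proof -
  interpret real_distribution "gamma_law 1" by (rule real_distribution_exponential)
  define c where "c = \<i> * complex_of_real t - 1"
  have Re: "Re c = -1" by (simp add: c_def)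
  then have "c \<noteq> 0" by auto
  have e: "cmod (exp (c * of_real x)) = exp (- x)" for x
    by (simp add: norm_exp_eq_Re Re)
  have D: "AE x in lborel. exponential_density 1 x *\<^sub>R iexp (t * x) = indicator (einterval 0 \<infinity>) x *\<^sub>R exp (c * of_real x)"
    using AE_lborel_singleton[of "0::real"]
    by eventually_elim (auto simp: exponential_density_def indicator_def einterval_iff c_def
        scaleR_conv_of_real exp_of_real[symmetric] exp_add[symmetric] algebra_simps simp del: exp_of_real)
  have "integrable (gamma_law 1) (\<lambda>x. iexp (t * x))" by (rule integrable_iexp) auto
  then have "integrable lborel (\<lambda>x. exponential_density 1 x *\<^sub>R iexp (t * x))"
    unfolding gamma_law_1 by (subst (asm) integrable_density) (auto simp: exponential_density_nonneg)
  then have int: "set_integrable lborel (einterval 0 \<infinity>) (\<lambda>x. exp (c * of_real x))"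
    unfolding set_integrable_def using D by (subst (asm) integrable_cong_AE) auto
  have "char (gamma_law 1) t = (CLINT x|lborel. exponential_density 1 x *\<^sub>R iexp (t * x))"
    unfolding char_def gamma_law_1 by (subst integral_density) (auto simp: exponential_density_nonneg)
  also have "\<dots> = (CLINT x|lborel. indicator (einterval 0 \<infinity>) x *\<^sub>R exp (c * of_real x))"
    using D by (intro integral_cong_AE) auto
  also have "\<dots> = (CLBINT x=0..\<infinity>. exp (c * of_real x))"
    by (simp add: interval_lebesgue_integral_def set_lebesgue_integral_def)
  also have "\<dots> = 0 - exp (c * of_real 0) / c"
  proof (rule interval_integral_FTC_integrable[OF _ _ _ int])
    show "((\<lambda>x. exp (c * of_real x) / c) has_vector_derivative exp (c * of_real x)) (at x)" for x
    proof -
      have "((\<lambda>w. exp (c * w) / c) has_field_derivative exp (c * of_real x)) (at (of_real x))"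
        using \<open>c \<noteq> 0\<close> by (auto intro!: derivative_eq_intros)
      from has_vector_derivative_real_field[OF this] show ?thesis .
    qed
    show "isCont (\<lambda>x. exp (c * complex_of_real x)) x" for x by (intro continuous_intros)
    have "((\<lambda>x. exp (c * complex_of_real x) / c) \<longlongrightarrow> exp (c * of_real 0) / c) (at_right 0)"
      using \<open>c \<noteq> 0\<close> by (intro tendsto_intros) auto
    then show "(((\<lambda>x. exp (c * of_real x) / c) \<circ> real_of_ereal) \<longlongrightarrow> exp (c * of_real 0) / c) (at_right 0)"
      unfolding zero_ereal_def by (simp add: ereal_tendsto_simps)
    have "((\<lambda>x. exp (- x)) \<longlongrightarrow> (0::real)) at_top"
      by (rule filterlim_compose[OF exp_at_bot filterlim_uminus_at_bot_at_top])
    then have "((\<lambda>x. cmod (exp (c * complex_of_real x))) \<longlongrightarrow> 0) at_top" by (simp only: e)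
    then have "((\<lambda>x. exp (c * complex_of_real x) / c) \<longlongrightarrow> 0 / c) at_top"
      using \<open>c \<noteq> 0\<close> by (intro tendsto_divide[OF tendsto_norm_zero_cancel tendsto_const])
    then show "(((\<lambda>x. exp (c * of_real x) / c) \<circ> real_of_ereal) \<longlongrightarrow> 0) (at_left \<infinity>)"
      by (simp add: ereal_tendsto_simps)
  qed simp
  also have "\<dots> = 1 / (1 - \<i> * t)" using \<open>c \<noteq> 0\<close> by (simp add: c_def field_simps)
  finally show ?thesis .
qed

text \<open>Serves to undo the image measure when an affine equation driven by the law of
  \<open>(C, Q)\<close> is translated back to the original coefficients.\<close>

lemma distr_pair_right:
  assumes "prob_space \<kappa>" "sets \<kappa> = sets borel" "prob_space N"
    and g[measurable]: "g \<in> N \<rightarrow>\<^sub>M N'" and h[measurable]: "h \<in> borel \<Otimes>\<^sub>M N' \<rightarrow>\<^sub>M K"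
  shows "distr (\<kappa> \<Otimes>\<^sub>M distr N N' g) K h = distr (\<kappa> \<Otimes>\<^sub>M N) K (\<lambda>(x, w). h (x, g w))"
proof -
  interpret \<kappa>: prob_space \<kappa> by fact
  interpret N: prob_space N by fact
  note [measurable_cong] = assms(2)
  have id: "distr \<kappa> borel (\<lambda>x. x) = \<kappa>" using assms(2) by (intro distr_id2) simp
  have "\<kappa> \<Otimes>\<^sub>M distr N N' g = distr (\<kappa> \<Otimes>\<^sub>M N) (borel \<Otimes>\<^sub>M N') (\<lambda>(x, w). (x, g w))"
    using pair_measure_distr[of "\<lambda>x. x" \<kappa> borel g N N'] id
    by (simp add: prob_space_imp_sigma_finite N.prob_space_distr)
  then show ?thesis
    by (simp add: distr_distr comp_def split_beta')
qed

section \<open>The beta and the gamma equation\<close>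

text \<open>What the later argument retains of the construction of \<open>(A, B)\<close>. The test
  functions are complex because characteristic functions are averaged.\<close>

locale beta_mixture = prob_space \<mu> for \<mu> :: "(real \<times> real) measure" +
  fixes y z :: real
  assumes pos: "y > 0" "z > 0" and sets_\<mu> [measurable_cong]: "sets \<mu> = sets (borel \<Otimes>\<^sub>M borel)"
    and range: "AE w in \<mu>. 0 \<le> snd w \<and> snd w \<le> fst w \<and> fst w \<le> 1"
    and mixture: "\<And>(f :: real \<times> real \<Rightarrow> complex) C. f \<in> borel_measurable (borel \<Otimes>\<^sub>M borel) \<Longrightarrow> (\<And>w. norm (f w) \<le> C) \<Longrightarrow>
      (CLINT w|\<mu>. f w) = (CLINT w|lborel. beta_density y z w *\<^sub>R (w *\<^sub>R f (w, 0) + (1 - w) *\<^sub>R f (1, w)))"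
begin

lemma integral_beta_density: "(\<integral>w. beta_density y z w \<partial>lborel) = 1"
proof -
  have "complex_of_real (\<integral>w. beta_density y z w \<partial>lborel) = 1"
    \<comment> \<open>Testing the mixture identity with the constant \<open>1\<close> gives the
      total mass without evaluating a Beta integral.\<close>
    using mixture[of "\<lambda>_. 1" 1]
    by (simp add: prob_space scaleR_conv_of_real algebra_simps)
  then show ?thesis by simp
qed

lemma integrable_beta_density: "integrable lborel (beta_density y z)"
  \<comment> \<open>A function that is not integrable would have integral \<open>0\<close>, not
    \<open>1\<close>.\<close>
  using integral_beta_density not_integrable_integral_eq by fastforce

text \<open>Reduces an identity for \<open>\<mu>\<close> to one for each fixed \<open>w\<close>, the
  form in which both distributional equations are checked.\<close>

lemma integral_eq_constI:
  assumes "f \<in> borel_measurable (borel \<Otimes>\<^sub>M borel)" "\<And>w. cmod (f w) \<le> C"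
    and eq: "\<And>w. 0 < w \<Longrightarrow> w < 1 \<Longrightarrow> w *\<^sub>R f (w, 0) + (1 - w) *\<^sub>R f (1, w) = c"
  shows "(CLINT w|\<mu>. f w) = c"
proof -
  have "(CLINT w|\<mu>. f w) = (CLINT w|lborel. beta_density y z w *\<^sub>R c)"
    unfolding mixture[OF assms(1,2)]
    by (intro Bochner_Integration.integral_cong refl) (auto simp: beta_density_def eq indicator_def)
  also have "\<dots> = c"
    by (subst integral_scaleR_left) (simp_all add: integral_beta_density integrable_beta_density)
  finally show ?thesis .
qed

text \<open>On \<open>(0, 1)\<close> the weight \<open>w * (1 - w)\<close> is positive, so a zero
  integral would make the density vanish almost everywhere, against its total mass
  \<open>1\<close>.\<close>

lemma integral_beta_density_weight: "0 < (\<integral>w. beta_density y z w * (w * (1 - w)) \<partial>lborel)"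
proof -
  have nn: "0 \<le> beta_density y z w * (w * (1 - w))" for w
  proof (cases "w \<in> {0<..<1}")
    case True
    then show ?thesis using beta_density_nonneg[OF pos, of w] by simp
  qed (auto simp: beta_density_def)
  have le: "beta_density y z w * (w * (1 - w)) \<le> beta_density y z w" for w
  proof (cases "w \<in> {0<..<1}")
    case True
    then have "w * (1 - w) \<le> 1" by (intro mult_le_one) auto
    then show ?thesis using beta_density_nonneg[OF pos, of w] by (simp add: mult_left_le)
  qed (auto simp: beta_density_def)
  have int': "integrable lborel (\<lambda>w. beta_density y z w * (w * (1 - w)))"
    by (rule Bochner_Integration.integrable_bound[OF integrable_beta_density])
      (use le nn beta_density_nonneg[OF pos] in auto)
  have "(\<integral>w. beta_density y z w * (w * (1 - w)) \<partial>lborel) \<noteq> 0"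
  proof
    assume "(\<integral>w. beta_density y z w * (w * (1 - w)) \<partial>lborel) = 0"
    then have "AE w in lborel. beta_density y z w * (w * (1 - w)) = 0"
      using integral_nonneg_eq_0_iff_AE[OF int'] nn by auto
    then have "AE w in lborel. beta_density y z w = 0"
      by eventually_elim (auto simp: beta_density_def)
    then have "(\<integral>w. beta_density y z w \<partial>lborel) = (\<integral>w. 0 \<partial>(lborel :: real measure))"
      by (intro integral_cong_AE) auto
    then show False using integral_beta_density by simp
  qed
  moreover have "0 \<le> (\<integral>w. beta_density y z w * (w * (1 - w)) \<partial>lborel)" using nn by simp
  ultimately show ?thesis by linarith
qed

text \<open>Averaging the pointwise defect \<open>k * (w * (1 - w))\<close> over the beta density
  gives a positive defect. It bounds the mean slope of both equations.\<close>

lemma integral_less_1: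
  fixes g :: "real \<times> real \<Rightarrow> real"
  assumes [measurable]: "g \<in> borel_measurable (borel \<Otimes>\<^sub>M borel)" and g: "AE w in \<mu>. g w \<in> {0..1}"
    and eq: "\<And>w. 0 < w \<Longrightarrow> w < 1 \<Longrightarrow> g (w, 0) \<in> {0..1} \<and> g (1, w) \<in> {0..1} \<and>
      1 - (w * g (w, 0) + (1 - w) * g (1, w)) = k * (w * (1 - w))"
    and k: "k > 0"
  shows "(\<integral>w. g w \<partial>\<mu>) < 1"
proof -
  \<comment> \<open>\<open>g\<close> lies in \<open>[0, 1]\<close> only almost everywhere, while
    \<open>mixture\<close> asks for a bound everywhere; hence the clamping.\<close>
  let ?h = "\<lambda>w. 1 - max 0 (min 1 (g w))"
  have int: "integrable \<mu> g" by (rule integrable_const_bound[of _ 1]) (use g in auto)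
  have norm_h: "cmod (complex_of_real (?h w)) \<le> 1" for w
    unfolding norm_of_real by auto
  have "(CLINT w|\<mu>. complex_of_real (?h w)) =
      (CLINT w|lborel. beta_density y z w *\<^sub>R (w *\<^sub>R complex_of_real (?h (w, 0)) + (1 - w) *\<^sub>R complex_of_real (?h (1, w))))"
    by (rule mixture[OF _ norm_h]) simp
  also have "\<dots> = (CLINT w|lborel. complex_of_real (k * (beta_density y z w * (w * (1 - w)))))"
  proof (intro Bochner_Integration.integral_cong refl)
    fix w :: real
    show "beta_density y z w *\<^sub>R (w *\<^sub>R complex_of_real (?h (w, 0)) + (1 - w) *\<^sub>R complex_of_real (?h (1, w))) =
      complex_of_real (k * (beta_density y z w * (w * (1 - w))))"
    proof (cases "w \<in> {0<..<1}")
      case True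
      then have "?h (w, 0) = 1 - g (w, 0)" "?h (1, w) = 1 - g (1, w)" using eq[of w] by auto
      then have "beta_density y z w * (w * ?h (w, 0) + (1 - w) * ?h (1, w)) =
          beta_density y z w * (1 - (w * g (w, 0) + (1 - w) * g (1, w)))"
        by (simp add: algebra_simps)
      also have "\<dots> = k * (beta_density y z w * (w * (1 - w)))"
        using eq[of w] True by simp
      finally show ?thesis
        by (simp only: scaleR_conv_of_real of_real_mult[symmetric] of_real_add[symmetric])
    qed (simp add: beta_density_def)
  qed
  also have "\<dots> = complex_of_real (k * (\<integral>w. beta_density y z w * (w * (1 - w)) \<partial>lborel))"
    by (simp only: integral_complex_of_real integral_mult_right_zero)
  finally have "(\<integral>w. ?h w \<partial>\<mu>) = k * (\<integral>w. beta_density y z w * (w * (1 - w)) \<partial>lborel)"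
    by (simp only: integral_complex_of_real of_real_eq_iff)
  moreover have "(\<integral>w. ?h w \<partial>\<mu>) = (\<integral>w. 1 - g w \<partial>\<mu>)"
    by (rule integral_cong_AE) (use g in auto)
  moreover have "(\<integral>w. 1 - g w \<partial>\<mu>) = 1 - (\<integral>w. g w \<partial>\<mu>)" using int by (simp add: prob_space)
  moreover have "k * (\<integral>w. beta_density y z w * (w * (1 - w)) \<partial>lborel) > 0"
    using k integral_beta_density_weight by simp
  ultimately show ?thesis by linarith
qed

section \<open>Both equations as affine equations, and their solutions\<close>

definition beta_step :: "(real \<times> real) measure" where
  "beta_step = distr \<mu> (borel \<Otimes>\<^sub>M borel) (\<lambda>w. (fst w - snd w, snd w))"

definition gamma_step :: "(real \<times> real) measure" where
  "gamma_step = distr (gamma_law 1 \<Otimes>\<^sub>M \<mu>) (borel \<Otimes>\<^sub>M borel) (\<lambda>(v, w). (fst w, snd w * v))"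

sublocale unif: real_distribution "beta_law 1 1" by (rule real_distribution_uniform)
sublocale expo: real_distribution "gamma_law 1" by (rule real_distribution_exponential)
sublocale expo_\<mu>: pair_prob_space "gamma_law 1" \<mu> ..

lemma beta_step_affine: "affine_recursion beta_step"
proof -
  interpret beta: prob_space beta_step unfolding beta_step_def by (rule prob_space_distr) measurable
  show ?thesis
  proof
    show "sets beta_step = sets (borel \<Otimes>\<^sub>M borel)" by (simp add: beta_step_def)
    show "AE w in beta_step. 0 \<le> fst w \<and> fst w \<le> 1"
      unfolding beta_step_def by (subst AE_distr_iff) (use range in auto)
    have "(\<integral>w. fst w \<partial>beta_step) = (\<integral>w. fst w - snd w \<partial>\<mu>)"
      unfolding beta_step_def by (subst integral_distr) auto
    also have "\<dots> < 1"
      \<comment> \<open>For the slope \<open>A - B\<close> the defect is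
        \<open>1 - w^2 - (1 - w)^2 = 2 * w * (1 - w)\<close>.\<close>
      by (rule integral_less_1[of _ 2]) (use range in \<open>auto simp: algebra_simps\<close>)
    finally show "(\<integral>w. fst w \<partial>beta_step) < 1" .
  qed
qed

lemma distr_gamma_law_snd: "distr (gamma_law 1 \<Otimes>\<^sub>M \<mu>) \<mu> snd = \<mu>"
proof -
  have "distr (gamma_law 1 \<Otimes>\<^sub>M \<mu>) \<mu> snd = distr (\<mu> \<Otimes>\<^sub>M gamma_law 1) \<mu> (snd \<circ> (\<lambda>(x, y). (y, x)))"
    by (subst expo_\<mu>.distr_pair_swap, subst distr_distr) auto
  also have "snd \<circ> (\<lambda>(x, y). (y, x)) = fst" by auto
  finally show ?thesis by (simp only: expo.distr_pair_fst)
qed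

lemma AE_gamma_pair: "AE w in gamma_law 1 \<Otimes>\<^sub>M \<mu>. 0 \<le> snd (snd w) \<and> snd (snd w) \<le> fst (snd w) \<and> fst (snd w) \<le> 1"
proof -
  have "AE w in distr (gamma_law 1 \<Otimes>\<^sub>M \<mu>) \<mu> snd. 0 \<le> snd w \<and> snd w \<le> fst w \<and> fst w \<le> 1"
    unfolding distr_gamma_law_snd by (rule range)
  from AE_distrD[OF _ this] show ?thesis by simp
qed

lemma gamma_step_affine: "affine_recursion gamma_step"
proof -
  interpret gamma: prob_space gamma_step unfolding gamma_step_def by (rule expo_\<mu>.prob_space_distr) measurable
  show ?thesis
  proof
    show "sets gamma_step = sets (borel \<Otimes>\<^sub>M borel)" by (simp add: gamma_step_def)
    show "AE w in gamma_step. 0 \<le> fst w \<and> fst w \<le> 1"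
      unfolding gamma_step_def by (subst AE_distr_iff) (use AE_gamma_pair in \<open>auto simp: split_beta\<close>)
    have "(\<integral>w. fst w \<partial>gamma_step) = (\<integral>w. fst (snd w) \<partial>(gamma_law 1 \<Otimes>\<^sub>M \<mu>))"
      unfolding gamma_step_def by (subst integral_distr) (auto simp: split_beta)
    also have "\<dots> = (\<integral>w. fst w \<partial>distr (gamma_law 1 \<Otimes>\<^sub>M \<mu>) \<mu> snd)"
      by (subst integral_distr) auto
    also have "\<dots> = (\<integral>w. fst w \<partial>\<mu>)" by (subst distr_gamma_law_snd) auto
    also have "\<dots> < 1"
      \<comment> \<open>For the slope \<open>A\<close> the defect is
        \<open>1 - w^2 - (1 - w) = w * (1 - w)\<close>.\<close>
      by (rule integral_less_1[of _ 1]) (use range in \<open>auto simp: algebra_simps\<close>)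
    finally show "(\<integral>w. fst w \<partial>gamma_step) < 1" .
  qed
qed

sublocale B: affine_recursion beta_step by (rule beta_step_affine)
sublocale G: affine_recursion gamma_step by (rule gamma_step_affine)

text \<open>For fixed \<open>w\<close> the branches give \<open>w * X\<close> and
  \<open>w + (1 - w) * X\<close>, uniform on \<open>[0, w]\<close> and \<open>[w, 1]\<close>; with
  weights \<open>w\<close> and \<open>1 - w\<close> they recombine to the uniform law on
  \<open>[0, 1]\<close>.\<close>

lemma uniform_solves: "solves_affine beta_step (beta_law 1 1)"
  unfolding B.solves_affine_iff_char
proof (intro conjI allI real_distribution_uniform)
  fix t
  have "(CLINT w|beta_step. iexp (t * snd w) * char (beta_law 1 1) (t * fst w)) =
    (CLINT w|\<mu>. iexp (t * snd w) * char (beta_law 1 1) (t * (fst w - snd w)))"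
    unfolding beta_step_def by (subst integral_distr) auto
  also have "\<dots> = char (beta_law 1 1) t"
  proof (rule integral_eq_constI[of _ 1])
    fix w :: real assume w: "0 < w" "w < 1"
    have "iexp (t * w) * iexp (t * (1 - w)) = iexp t"
      by (simp add: exp_add[symmetric] algebra_simps)
    then show "w *\<^sub>R (iexp (t * snd (w, 0)) * char (beta_law 1 1) (t * (fst (w, 0) - snd (w, 0)))) +
       (1 - w) *\<^sub>R (iexp (t * snd (1, w)) * char (beta_law 1 1) (t * (fst (1, w) - snd (1, w)))) =
       char (beta_law 1 1) t"
      using w unfolding char_uniform
      by (cases "t = 0") (simp_all add: scaleR_conv_of_real divide_simps, simp_all add: algebra_simps)
  qed (auto simp: norm_mult unif.cmod_char_le_1)
  finally show "char (beta_law 1 1) t =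
    (CLINT w|beta_step. iexp (t * snd w) * char (beta_law 1 1) (t * fst w))" ..
qed

text \<open>With \<open>V\<close> integrated out, the identity for fixed \<open>w\<close> is
  \<open>w * \<phi>(t w) + (1 - w) * \<phi>(t) * \<phi>(t w) = \<phi>(t)\<close>, where
  \<open>\<phi>(s) = 1 / (1 - \<i> s)\<close>.\<close>

lemma exponential_solves: "solves_affine gamma_step (gamma_law 1)"
  unfolding G.solves_affine_iff_char
proof (intro conjI allI real_distribution_exponential)
  fix t
  let ?\<phi> = "char (gamma_law 1)"
  let ?f = "\<lambda>v w. iexp (t * (snd w * v)) * ?\<phi> (t * fst w)"
  have int: "integrable (gamma_law 1 \<Otimes>\<^sub>M \<mu>) (case_prod ?f)"
    by (rule expo_\<mu>.P.integrable_const_bound[of _ 1])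
      (auto simp: split_beta' norm_mult expo.cmod_char_le_1)
  have "(CLINT w|gamma_step. iexp (t * snd w) * ?\<phi> (t * fst w)) = (CLINT p|gamma_law 1 \<Otimes>\<^sub>M \<mu>. case_prod ?f p)"
    unfolding gamma_step_def by (subst integral_distr) (simp_all add: split_beta')
  also have "\<dots> = (CLINT w|\<mu>. CLINT v|gamma_law 1. ?f v w)"
    by (rule expo_\<mu>.integral_snd[OF int, symmetric])
  also have "\<dots> = (CLINT w|\<mu>. ?\<phi> (t * snd w) * ?\<phi> (t * fst w))"
    by (simp add: char_def mult.assoc)
  also have "\<dots> = ?\<phi> t"
  proof (rule integral_eq_constI[of _ 1])
    fix w :: real assume w: "0 < w" "w < 1"
    have nz: "1 - \<i> * complex_of_real s \<noteq> 0" for s by (simp add: complex_eq_iff)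
    show "w *\<^sub>R (?\<phi> (t * snd (w, 0)) * ?\<phi> (t * fst (w, 0))) + (1 - w) *\<^sub>R (?\<phi> (t * snd (1, w)) * ?\<phi> (t * fst (1, w))) = ?\<phi> t"
      unfolding char_exponential using nz[of t] nz[of "t * w"]
      by (simp add: scaleR_conv_of_real divide_simps) (simp add: algebra_simps)
  qed (auto simp: norm_mult intro!: mult_le_one expo.cmod_char_le_1)
  finally show "?\<phi> t = (CLINT w|gamma_step. iexp (t * snd w) * ?\<phi> (t * fst w))" ..
qed

text \<open>\<open>A * x + B * (1 - x) = (A - B) * x + B\<close> makes this an affine equation, for
  which a solution and uniqueness are known.\<close>

lemma solves_beta_eq_iff: "solves_beta_eq \<mu> \<kappa> \<longleftrightarrow> \<kappa> = beta_law 1 1"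
proof -
  have "solves_beta_eq \<mu> \<kappa> \<longleftrightarrow> solves_affine beta_step \<kappa>"
  proof (cases "prob_space \<kappa> \<and> sets \<kappa> = sets borel")
    case True
    then have "distr (\<kappa> \<Otimes>\<^sub>M beta_step) borel (\<lambda>(x, c, q). c * x + q) =
        distr (\<kappa> \<Otimes>\<^sub>M \<mu>) borel (\<lambda>(x, w). (\<lambda>(x, c, q). c * x + q) (x, (fst w - snd w, snd w)))"
      unfolding beta_step_def by (intro distr_pair_right prob_space_axioms) auto
    also have "\<dots> = distr (\<kappa> \<Otimes>\<^sub>M \<mu>) borel (\<lambda>(x, A, B). A * x + B * (1 - x))"
      by (intro arg_cong[of _ _ "distr _ _"]) (auto simp: fun_eq_iff algebra_simps)
    finally show ?thesis by (simp add: solves_beta_eq_def solves_affine_def)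
  qed (auto simp: solves_beta_eq_def solves_affine_def)
  then show ?thesis using uniform_solves B.solves_affine_unique by blast
qed

lemma solves_gamma_eq_iff: "solves_gamma_eq \<mu> (gamma_law 1) \<kappa> \<longleftrightarrow> \<kappa> = gamma_law 1"
proof -
  have "solves_gamma_eq \<mu> (gamma_law 1) \<kappa> \<longleftrightarrow> solves_affine gamma_step \<kappa>"
  proof (cases "prob_space \<kappa> \<and> sets \<kappa> = sets borel")
    case True
    then have "distr (\<kappa> \<Otimes>\<^sub>M gamma_step) borel (\<lambda>(x, c, q). c * x + q) =
        distr (\<kappa> \<Otimes>\<^sub>M (gamma_law 1 \<Otimes>\<^sub>M \<mu>)) borel (\<lambda>(x, w). (\<lambda>(x, c, q). c * x + q) (x, (\<lambda>(v, w). (fst w, snd w * v)) w))"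
      unfolding gamma_step_def by (intro distr_pair_right expo_\<mu>.P.prob_space_axioms) auto
    also have "\<dots> = distr (\<kappa> \<Otimes>\<^sub>M (gamma_law 1 \<Otimes>\<^sub>M \<mu>)) borel (\<lambda>(v1, v2, A, B). A * v1 + B * v2)"
      by (intro arg_cong[of _ _ "distr _ _"]) (auto simp: fun_eq_iff algebra_simps)
    finally show ?thesis by (simp add: solves_gamma_eq_def solves_affine_def)
  qed (auto simp: solves_gamma_eq_def solves_affine_def)
  then show ?thesis using exponential_solves G.solves_affine_unique by blast
qed

lemma integrable_beta_step: "integrable beta_step snd"
  unfolding beta_step_def
  by (subst integrable_distr_eq) (use range in \<open>auto intro!: integrable_const_bound[of _ 1]\<close>)

section \<open>The given i.i.d. sequence as input of the two affine recursions\<close>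

context
  fixes S :: "'s measure" and As Bs Vs :: "nat \<Rightarrow> 's \<Rightarrow> real"
  assumes S: "prob_space S"
    and indep: "prob_space.indep_vars S (\<lambda>_. (borel \<Otimes>\<^sub>M borel) \<Otimes>\<^sub>M borel) (\<lambda>n \<omega>. ((As n \<omega>, Bs n \<omega>), Vs n \<omega>)) {1..}"
    and law: "\<And>n. n \<ge> 1 \<Longrightarrow>
      distr S ((borel \<Otimes>\<^sub>M borel) \<Otimes>\<^sub>M borel) (\<lambda>\<omega>. ((As n \<omega>, Bs n \<omega>), Vs n \<omega>)) = \<mu> \<Otimes>\<^sub>M gamma_law 1"
begin

interpretation S: prob_space S by (rule S)

lemma ABV_measurable:
  "n \<ge> 1 \<Longrightarrow> (\<lambda>\<omega>. ((As n \<omega>, Bs n \<omega>), Vs n \<omega>)) \<in> S \<rightarrow>\<^sub>M (borel \<Otimes>\<^sub>M borel) \<Otimes>\<^sub>M borel"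
  using indep by (auto simp: S.indep_vars_def)

lemma iid_beta_step:
  "iid_affine_maps beta_step S (\<lambda>n \<omega>. As n \<omega> - Bs n \<omega>) Bs (beta_law 1 1)"
proof unfold_locales
  let ?g = "\<lambda>p :: (real \<times> real) \<times> real. (fst (fst p) - snd (fst p), snd (fst p))"
  show "S.indep_vars (\<lambda>_. borel \<Otimes>\<^sub>M borel) (\<lambda>n \<omega>. (As n \<omega> - Bs n \<omega>, Bs n \<omega>)) {1..}"
    using S.indep_vars_compose2[OF indep, of "\<lambda>_. ?g" "\<lambda>_. borel \<Otimes>\<^sub>M borel"] by simp
  fix n :: nat assume n: "n \<ge> 1"
  have "distr S (borel \<Otimes>\<^sub>M borel) (\<lambda>\<omega>. (As n \<omega> - Bs n \<omega>, Bs n \<omega>)) =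
      distr (\<mu> \<Otimes>\<^sub>M gamma_law 1) (borel \<Otimes>\<^sub>M borel) ?g"
    unfolding law[OF n, symmetric] by (subst distr_distr[OF _ ABV_measurable[OF n]]) (simp_all add: comp_def)
  also have "\<dots> = distr (distr (\<mu> \<Otimes>\<^sub>M gamma_law 1) \<mu> fst) (borel \<Otimes>\<^sub>M borel) (\<lambda>w. (fst w - snd w, snd w))"
    by (subst distr_distr) (auto simp: comp_def)
  also have "\<dots> = beta_step"
    by (simp add: expo.distr_pair_fst beta_step_def)
  finally show "distr S (borel \<Otimes>\<^sub>M borel) (\<lambda>\<omega>. (As n \<omega> - Bs n \<omega>, Bs n \<omega>)) = beta_step" .
qed (rule uniform_solves integrable_uniform)+

lemma iid_gamma_step:
  "iid_affine_maps gamma_step S As (\<lambda>n \<omega>. Bs n \<omega> * Vs n \<omega>) (gamma_law 1)"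
proof unfold_locales
  let ?g = "\<lambda>p :: (real \<times> real) \<times> real. (fst (fst p), snd (fst p) * snd p)"
  show "S.indep_vars (\<lambda>_. borel \<Otimes>\<^sub>M borel) (\<lambda>n \<omega>. (As n \<omega>, Bs n \<omega> * Vs n \<omega>)) {1..}"
    using S.indep_vars_compose2[OF indep, of "\<lambda>_. ?g" "\<lambda>_. borel \<Otimes>\<^sub>M borel"] by simp
  fix n :: nat assume n: "n \<ge> 1"
  \<comment> \<open>The sequence has law \<open>\<mu>\<close> times gamma, while
    \<open>gamma_step\<close> is built from gamma times \<open>\<mu>\<close>, so the factors are
    exchanged.\<close>
  interpret swap: pair_prob_space \<mu> "gamma_law 1" ..
  have "distr S (borel \<Otimes>\<^sub>M borel) (\<lambda>\<omega>. (As n \<omega>, Bs n \<omega> * Vs n \<omega>)) =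
      distr (\<mu> \<Otimes>\<^sub>M gamma_law 1) (borel \<Otimes>\<^sub>M borel) ?g"
    unfolding law[OF n, symmetric] by (subst distr_distr[OF _ ABV_measurable[OF n]]) (simp_all add: comp_def)
  also have "\<dots> = gamma_step"
    unfolding gamma_step_def
    by (subst swap.distr_pair_swap, subst distr_distr)
      (simp_all add: comp_def split_beta')
  finally show "distr S (borel \<Otimes>\<^sub>M borel) (\<lambda>\<omega>. (As n \<omega>, Bs n \<omega> * Vs n \<omega>)) = gamma_step" .
qed (rule exponential_solves integrable_exponential)+

end

end

theorem theorem4:
  fixes y z p a b :: real
    and M :: "'m measure" and Ip :: "'m \<Rightarrow> bool" and L R :: "'m \<Rightarrow> real"
    and K :: "'k measure" and A B :: "'k \<Rightarrow> real" and \<mu> :: "(real \<times> real) measure"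
    and S :: "'s measure" and As Bs Vs :: "nat \<Rightarrow> 's \<Rightarrow> real"
    and F G :: "'s \<Rightarrow> nat \<Rightarrow> real \<Rightarrow> real" and Xs Ys Xs' :: "nat \<Rightarrow> real \<Rightarrow> 's \<Rightarrow> real"
  assumes "y > 0" and "z > 0" and "p = y / (y + z)"
    and "prob_space M"
    and "distr M (count_space UNIV) Ip = measure_pmf (bernoulli_pmf p)"
    and "\<forall>\<omega>\<in>space M. L \<omega> \<in> {0..<1} \<and> R \<omega> \<in> {0..<1}"
    and "indep_elements M (count_space UNIV) Ip (borel \<Otimes>\<^sub>M borel) (\<lambda>\<omega>. (L \<omega>, R \<omega>))"
    and "distr M borel L = beta_law z (y + 1)"
    and "distr M borel R = beta_law y (z + 1)"
    and "prob_space K"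
    and "(\<lambda>\<omega>. (A \<omega>, B \<omega>)) \<in> K \<rightarrow>\<^sub>M borel \<Otimes>\<^sub>M borel"
    and "distr K (borel \<Otimes>\<^sub>M borel) (\<lambda>\<omega>. (A \<omega>, B \<omega>)) =
         distr M (borel \<Otimes>\<^sub>M borel)
           (\<lambda>\<omega>. of_bool (Ip \<omega>) *\<^sub>R (1 - L \<omega>, 0) + (1 - of_bool (Ip \<omega>)) *\<^sub>R (1, R \<omega>))"
    and "\<mu> = distr K (borel \<Otimes>\<^sub>M borel) (\<lambda>\<omega>. (A \<omega>, B \<omega>))"
    and "a = 1" and "b = 1"
    and "prob_space S"
    and "prob_space.indep_vars S (\<lambda>_. (borel \<Otimes>\<^sub>M borel) \<Otimes>\<^sub>M borel)
           (\<lambda>n \<omega>. ((As n \<omega>, Bs n \<omega>), Vs n \<omega>)) {1..}"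
    and "\<forall>n\<ge>1. distr S ((borel \<Otimes>\<^sub>M borel) \<Otimes>\<^sub>M borel) (\<lambda>\<omega>. ((As n \<omega>, Bs n \<omega>), Vs n \<omega>)) =
           \<mu> \<Otimes>\<^sub>M gamma_law b"
    and "\<forall>\<omega> n. F \<omega> n = beta_map (As n \<omega>) (Bs n \<omega>)"
    and "\<forall>\<omega> n. G \<omega> n = gamma_map (As n \<omega>) (Bs n \<omega>) (Vs n \<omega>)"
    and "\<forall>n x \<omega>. Xs n x \<omega> = forward_iter (F \<omega>) n x"
    and "\<forall>n x \<omega>. Ys n x \<omega> = backward_iter (F \<omega>) n x"
    and "\<forall>n x \<omega>. Xs' n x \<omega> = forward_iter (G \<omega>) n x"
  shows "(\<forall>\<kappa>. solves_gamma_eq \<mu> (gamma_law b) \<kappa> \<longleftrightarrow> \<kappa> = gamma_law a)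
    \<and> (\<forall>\<kappa>. solves_beta_eq \<mu> \<kappa> \<longleftrightarrow> \<kappa> = beta_law a b)
    \<and> (\<exists>Y \<in> borel_measurable S. distr S borel Y = beta_law a b \<and>
         (AE \<omega> in S. uniform_limit {0..1} (\<lambda>n x. Ys n x \<omega>) (\<lambda>_. Y \<omega>) sequentially))
    \<and> (\<forall>x\<in>{0..1}. weak_conv_m (\<lambda>n. distr S borel (Xs n x)) (beta_law a b))
    \<and> (\<forall>x'\<in>{0<..}. weak_conv_m (\<lambda>n. distr S borel (Xs' n x')) (gamma_law a))"
proof -
  interpret M: prob_space M by fact
  let ?W = "\<lambda>\<omega>. of_bool (Ip \<omega>) *\<^sub>R (1 - L \<omega>, 0) + (1 - of_bool (Ip \<omega>)) *\<^sub>R (1, R \<omega>)"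
  have [measurable]: "Ip \<in> M \<rightarrow>\<^sub>M count_space UNIV"
    and LR: "(\<lambda>\<omega>. (L \<omega>, R \<omega>)) \<in> M \<rightarrow>\<^sub>M borel \<Otimes>\<^sub>M borel"
    using assms(7) by (auto simp: indep_elements_def)
  have [measurable]: "L \<in> borel_measurable M" "R \<in> borel_measurable M"
    using measurable_compose[OF LR measurable_fst] measurable_compose[OF LR measurable_snd] by simp_all
  have W[measurable]: "?W \<in> M \<rightarrow>\<^sub>M borel \<Otimes>\<^sub>M borel" by simp
  have \<mu>: "\<mu> = distr M (borel \<Otimes>\<^sub>M borel) ?W" using assms(12,13) by simp
  interpret prob_space \<mu> unfolding \<mu> by (rule M.prob_space_distr) (rule W)
  interpret beta_mixture \<mu> y z
  proof
    \<comment> \<open>Both values \<open>(1 - L, 0)\<close> and \<open>(1, R)\<close> of the mixture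
      satisfy this since \<open>L\<close> and \<open>R\<close> lie in \<open>[0, 1)\<close>.\<close>
    show "AE w in \<mu>. 0 \<le> snd w \<and> snd w \<le> fst w \<and> fst w \<le> 1"
      unfolding \<mu> by (subst AE_distr_iff[OF W]) (use assms(6) in \<open>auto simp: of_bool_def intro!: AE_I2\<close>)
    show "(CLINT w|\<mu>. f w) = (CLINT w|lborel. beta_density y z w *\<^sub>R (w *\<^sub>R f (w, 0) + (1 - w) *\<^sub>R f (1, w)))"
      if "f \<in> borel_measurable (borel \<Otimes>\<^sub>M borel)" "\<And>w. cmod (f w) \<le> C" for f C
      unfolding \<mu> using assms that by (intro integral_mixture)
  qed (use assms in \<open>simp_all add: \<mu>\<close>)
  have law: "distr S ((borel \<Otimes>\<^sub>M borel) \<Otimes>\<^sub>M borel) (\<lambda>\<omega>. ((As n \<omega>, Bs n \<omega>), Vs n \<omega>)) = \<mu> \<Otimes>\<^sub>M gamma_law 1"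
    if "n \<ge> 1" for n using assms that by simp
  interpret BI: iid_affine_maps beta_step S "\<lambda>n \<omega>. As n \<omega> - Bs n \<omega>" Bs "beta_law 1 1"
    by (rule iid_beta_step[OF assms(16,17) law])
  interpret GI: iid_affine_maps gamma_step S As "\<lambda>n \<omega>. Bs n \<omega> * Vs n \<omega>" "gamma_law 1"
    by (rule iid_gamma_step[OF assms(16,17) law])
  have F: "F \<omega> n = (\<lambda>x. (As n \<omega> - Bs n \<omega>) * x + Bs n \<omega>)" for \<omega> n
    using assms(19) by (simp add: fun_eq_iff beta_map_def algebra_simps)
  have G: "G \<omega> n = (\<lambda>x. As n \<omega> * x + Bs n \<omega> * Vs n \<omega>)" for \<omega> n
    using assms(20) by (simp add: fun_eq_iff gamma_map_def)
  have X: "Xs n x = (\<lambda>\<omega>. forward_iter (F \<omega>) n x)" for n x using assms(21) by auto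
  have X': "Xs' n x = (\<lambda>\<omega>. forward_iter (G \<omega>) n x)" for n x using assms(23) by auto
  have "weak_conv_m (\<lambda>n. distr S borel (Xs n x)) (beta_law 1 1)" for x
    by (rule BI.forward_weak_conv[where x=x]) (simp_all add: X F)
  moreover have "weak_conv_m (\<lambda>n. distr S borel (Xs' n x)) (gamma_law 1)" for x
    by (rule GI.forward_weak_conv[where x=x]) (simp_all add: X' G)
  moreover have "\<exists>Y \<in> borel_measurable S. distr S borel Y = beta_law 1 1 \<and>
         (AE \<omega> in S. uniform_limit {0..1} (\<lambda>n x. Ys n x \<omega>) (\<lambda>_. Y \<omega>) sequentially)"
    using BI.backward_uniform_limit[OF integrable_beta_step, of F] F assms(22) by simp
  ultimately show ?thesis
    using solves_beta_eq_iff solves_gamma_eq_iff assms(14,15) by simp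
qed

end
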